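(* Let $G$ be a connected series-parallel graph and let $e \in E(G)$ be neither a bridge nor a loop. Then there exists $\varepsilon > 0$ such that $\mathrm{ex}(Q_n, Y(G,e)) = O(n^{-\varepsilon} e(Q_n))$ as $n\to\infty$, where $e(Q_n) = n2^{n-1}$ is the number of edges of $Q_n$.
   Context: Graphs here may be multigraphs (loops and parallel edges allowed). A series-parallel graph is a multigraph with no $K_4$ minor. A spanning tree of a multigraph is a set of edges forming a tree containing every vertex. $Q_n$ is the $n$-dimensional hypercube with vertex set $\{0,1\}^n$. For $d \le n$, an embedding $Q_d \to Q_n$ is a graph isomorphism of $Q_d$ onto a $d$-dimensional face (subcube) of $Q_n$; it maps edges to edges. For $Y \subseteq E(Q_d)$, $\mathrm{ex}(Q_n, Y)$ is the maximum size of a set $S \subseteq E(Q_n)$ such that $\psi(Y) \not\subseteq S$ for every embedding $\psi: Q_d \to Q_n$. Given $G$ and $e$ as in the claim, fix an ordering of $E(G)\setminus\{e\}$, so that subsets of $E(G)\setminus\{e\}$ are identified with vertices of $Q_{e(G)-1}$. Then $Y(G,e) \subseteq E(Q_{e(G)-1})$ is the set of hypercube edges $\{S, S\cup\{e'\}\}$ (with $S \subseteq E(G)\setminus\{e\}$, $e' \in E(G)\setminus(S\cup\{e\})$) such that both $S\cup\{e\}$ and $S \cup \{e'\}$ are edge sets of spanning trees of $G$. *)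

theory Defs
  imports Complex_Main "HOL-Library.Disjoint_Sets" "HOL-Library.Landau_Symbols"
begin

section \<open>Multigraphs\<close>

record ('v, 'e) mgraph =
  verts :: "'v set"
  edges :: "'e set"
  ends :: "'e \<Rightarrow> 'v set"

locale fin_multigraph =
  fixes G :: "('v, 'e) mgraph" (structure)
  assumes finite_verts: "finite (verts G)"
    and finite_edges: "finite (edges G)"
    and ends_in_verts: "f \<in> edges G \<Longrightarrow> ends G f \<subseteq> verts G"
    and card_ends: "f \<in> edges G \<Longrightarrow> card (ends G f) = 1 \<or> card (ends G f) = 2"

definition is_loop :: "('v, 'e) mgraph \<Rightarrow> 'e \<Rightarrow> bool" where
  "is_loop G f \<longleftrightarrow> f \<in> edges G \<and> (\<exists>v. ends G f = {v})"

definition adj :: "('v, 'e) mgraph \<Rightarrow> ('v \<times> 'v) set" where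
  "adj G = {(u, v). \<exists>f\<in>edges G. ends G f = {u, v}}"

definition mconnected :: "('v, 'e) mgraph \<Rightarrow> bool" where
  "mconnected G \<longleftrightarrow> verts G \<noteq> {} \<and> (\<forall>u\<in>verts G. \<forall>v\<in>verts G. (u, v) \<in> (adj G)\<^sup>*)"

definition delete_edge :: "('v, 'e) mgraph \<Rightarrow> 'e \<Rightarrow> ('v, 'e) mgraph" where
  "delete_edge G f = G\<lparr>edges := edges G - {f}\<rparr>"

definition is_bridge :: "('v, 'e) mgraph \<Rightarrow> 'e \<Rightarrow> bool" where
  "is_bridge G f \<longleftrightarrow> f \<in> edges G \<and>
     (\<exists>u\<in>verts G. \<exists>v\<in>verts G. (u, v) \<in> (adj G)\<^sup>* \<and> (u, v) \<notin> (adj (delete_edge G f))\<^sup>*)"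

text \<open>A cycle is a cyclic sequence of distinct vertices and distinct edges. Length 1 is a loop,
  length 2 is a pair of parallel edges.\<close>

definition is_cycle :: "('v, 'e) mgraph \<Rightarrow> 'v list \<Rightarrow> 'e list \<Rightarrow> bool" where
  "is_cycle G vs es \<longleftrightarrow> vs \<noteq> [] \<and> length es = length vs \<and> distinct vs \<and> distinct es \<and>
     set vs \<subseteq> verts G \<and> set es \<subseteq> edges G \<and>
     (\<forall>i<length vs. ends G (es ! i) = {vs ! i, vs ! (Suc i mod length vs)})"

definition is_tree :: "('v, 'e) mgraph \<Rightarrow> bool" where
  "is_tree G \<longleftrightarrow> mconnected G \<and> \<not> (\<exists>vs es. is_cycle G vs es)"

definition spanning_tree :: "('v, 'e) mgraph \<Rightarrow> 'e set \<Rightarrow> bool" where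
  "spanning_tree G T \<longleftrightarrow> T \<subseteq> edges G \<and> is_tree (G\<lparr>edges := T\<rparr>)"

definition subgraph_on :: "('v, 'e) mgraph \<Rightarrow> 'v set \<Rightarrow> 'e set \<Rightarrow> ('v, 'e) mgraph" where
  "subgraph_on G B C = \<lparr>verts = B, edges = {f \<in> C. ends G f \<subseteq> B}, ends = ends G\<rparr>"

text \<open>\<open>H\<close> is a minor of \<open>G\<close> if it arises from a subgraph of \<open>G\<close> by contracting edges, up to
  isomorphism. Here \<open>C\<close> is the set of contracted edges, the branch set \<open>B x\<close> is
  contracted to the vertex \<open>x\<close> of \<open>H\<close>, and the edge \<open>\<phi> f\<close> of \<open>G\<close> becomes the edge \<open>f\<close> of \<open>H\<close>;
  vertices and edges of \<open>G\<close> not used in this way are deleted. The edges \<open>\<phi> f\<close> have to avoid \<open>C\<close>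
  because loops of \<open>H\<close> come from edges inside a branch set.\<close>

definition is_minor :: "('a, 'b) mgraph \<Rightarrow> ('v, 'e) mgraph \<Rightarrow> bool" where
  "is_minor H G \<longleftrightarrow> (\<exists>B C \<phi>.
     C \<subseteq> edges G \<and>
     (\<forall>x\<in>verts H. B x \<subseteq> verts G \<and> mconnected (subgraph_on G (B x) C)) \<and>
     disjoint_family_on B (verts H) \<and>
     inj_on \<phi> (edges H) \<and> \<phi> ` edges H \<subseteq> edges G - C \<and>
     (\<forall>f\<in>edges H. ends G (\<phi> f) \<subseteq> (\<Union>x\<in>ends H f. B x) \<and>
                  (\<forall>x\<in>ends H f. ends G (\<phi> f) \<inter> B x \<noteq> {})))"

definition complete_graph :: "nat \<Rightarrow> (nat, nat set) mgraph" where
  "complete_graph k = \<lparr>verts = {..<k}, edges = {f. f \<subseteq> {..<k} \<and> card f = 2}, ends = (\<lambda>f. f)\<rparr>"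

definition series_parallel :: "('v, 'e) mgraph \<Rightarrow> bool" where
  "series_parallel G \<longleftrightarrow> fin_multigraph G \<and> \<not> is_minor (complete_graph 4) G"

section \<open>Hypercubes\<close>

text \<open>A vertex of \<open>Q\<^sub>n\<close>, i.e. a 0/1-vector indexed by \<open>{..<n}\<close>, is represented by the set
  of those coordinates that are 1. Edges are unordered pairs of vertices.\<close>

definition cube_verts :: "nat \<Rightarrow> nat set set" where
  "cube_verts n = Pow {..<n}"

definition cube_edges :: "nat \<Rightarrow> nat set set set" where
  "cube_edges n = {{X, insert i X} | X i. X \<in> cube_verts n \<and> i < n \<and> i \<notin> X}"

text \<open>The face with free coordinates \<open>D\<close>, the coordinates outside \<open>D\<close> being fixed to the
  values they have in \<open>A\<close>.\<close>

definition face :: "nat \<Rightarrow> nat set \<Rightarrow> nat set \<Rightarrow> nat set set" where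
  "face n D A = {X \<in> cube_verts n. X - D = A - D}"

definition is_face :: "nat \<Rightarrow> nat \<Rightarrow> nat set set \<Rightarrow> bool" where
  "is_face d n F \<longleftrightarrow> (\<exists>D A. D \<subseteq> {..<n} \<and> card D = d \<and> A \<in> cube_verts n \<and> F = face n D A)"

definition cube_embedding :: "nat \<Rightarrow> nat \<Rightarrow> (nat set \<Rightarrow> nat set) \<Rightarrow> bool" where
  "cube_embedding d n \<psi> \<longleftrightarrow>
     (\<exists>F. is_face d n F \<and> bij_betw \<psi> (cube_verts d) F) \<and>
     (\<forall>X\<in>cube_verts d. \<forall>X'\<in>cube_verts d.
        {X, X'} \<in> cube_edges d \<longleftrightarrow> {\<psi> X, \<psi> X'} \<in> cube_edges n)"

definition cube_ex :: "nat \<Rightarrow> nat \<Rightarrow> nat set set set \<Rightarrow> nat" where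
  "cube_ex d n Y = Max {card S | S. S \<subseteq> cube_edges n \<and>
     (\<forall>\<psi>. cube_embedding d n \<psi> \<longrightarrow> \<not> (\<lambda>f. \<psi> ` f) ` Y \<subseteq> S)}"

lemma card_cube_edges: "card (cube_edges n) = n * 2 ^ (n - 1)"
proof -
  let ?A = "SIGMA i:{..<n}. Pow ({..<n} - {i})"
  let ?g = "\<lambda>(i, X). {X, insert i X}"
  have "cube_edges n = ?g ` ?A"
    by (auto simp: cube_edges_def cube_verts_def image_iff)
  moreover have "inj_on ?g ?A"
    by (auto simp: inj_on_def doubleton_eq_iff)
  ultimately have "card (cube_edges n) = card ?A"
    by (simp add: card_image)
  also have "\<dots> = (\<Sum>i<n. 2 ^ (n - 1))"
    by (subst card_SigmaI) (auto simp: card_Pow card_Diff_singleton)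
  finally show ?thesis by simp
qed

section \<open>The configuration of a graph and an edge\<close>

text \<open>The bijection \<open>\<sigma>\<close> from \<open>{..<card (edges G) - 1}\<close> onto \<open>edges G - {e}\<close> is the chosen ordering
  of \<open>edges G - {e}\<close>; it identifies \<open>S\<close> with the edge set \<open>\<sigma> ` S\<close>.\<close>

definition Y_config :: "('v, 'e) mgraph \<Rightarrow> 'e \<Rightarrow> (nat \<Rightarrow> 'e) \<Rightarrow> nat set set set" where
  "Y_config G e \<sigma> = {{S, insert i S} | S i.
     S \<in> cube_verts (card (edges G) - 1) \<and> i < card (edges G) - 1 \<and> i \<notin> S \<and>
     spanning_tree G (insert e (\<sigma> ` S)) \<and> spanning_tree G (insert (\<sigma> i) (\<sigma> ` S))}"

end

(*
  A tree S + x avoiding e and a tree S + e differ by an exchange, so Y(G,e) consists of pairs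
  (S, x), realised in the cube by a base set A and an injection of E(G) - {e} into the
  coordinates.  The quantity that is propagated is a supersaturation bound: a set of cube edges of
  density delta contains at least c delta^C - K/n of all such copies.  Doubling an edge f in parallel
  keeps a bound of this form: by Cauchy-Schwarz there are many pairs of copies that differ only in
  the image of f, and such a pair is a copy of the doubled configuration.  Complementation in the
  cube turns series extensions into parallel ones; loops and bridges are degenerate instances.

  So it suffices to reduce G to two parallel edges without touching e = st.  If G has neither loops
  nor parallel pairs outside e, absence of a K4 minor yields a vertex other than s, t of degree at
  most 2, where an edge can be contracted.  That vertex is found by contracting edges xy of a
  minimal counterexample: every such contraction must destroy the degree condition at a common
  neighbour of degree 3, which forces two adjacent vertices with the same two other neighbours, and
  these either yield a K4 minor or separate off a smaller counterexample.
*)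
theory Submission
  imports Defs "HOL-Combinatorics.Transposition" "HOL-Analysis.Convex"
begin

section \<open>Copies of a pattern of cube edges, and how their number behaves under doubling an
  element\<close>

section \<open>Supersaturation of exchange configurations\<close>

text \<open>A pair \<open>(S, x)\<close> stands for the cube edge with lower end \<open>S\<close>
  and direction \<open>x\<close>. The ground set is arbitrary, so patterns over the edges of a graph
  and the host cube over \<open>{..<n}\<close> are encoded alike.\<close>

definition pointed :: "'a set \<Rightarrow> ('a set \<times> 'a) set" where
  "pointed D = {(S, x). S \<subseteq> D \<and> x \<in> D \<and> x \<notin> S}"

text \<open>\<open>\<phi>\<close> places the free coordinates and \<open>A\<close> holds the fixed
  coordinates with value 1, so a copy is a subcube with labelled directions. Without the condition
  on \<open>Es\<close> there are about \<open>n ^ card D * 2 ^ (n - card D)\<close> of them, up to a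
  constant the normalisation in \<open>power_saving\<close>.\<close>

definition copies :: "nat \<Rightarrow> 'a set \<Rightarrow> ('a set \<times> 'a) set \<Rightarrow> (nat set \<times> nat) set \<Rightarrow>
    (nat set \<times> ('a \<Rightarrow> nat)) set" where
  "copies n D P Es = {(A, \<phi>). A \<subseteq> {..<n} \<and> \<phi> \<in> D \<rightarrow>\<^sub>E {..<n} \<and> inj_on \<phi> D \<and> A \<inter> \<phi> ` D = {} \<and>
     (\<forall>(S, x)\<in>P. (A \<union> \<phi> ` S, \<phi> x) \<in> Es)}"

text \<open>The constants depend neither on \<open>n\<close> nor on \<open>Es\<close>. A set without
  copies then has density at most a constant times a negative power of \<open>n\<close>. The error
  \<open>K / real n\<close> leaves room for degenerate pairs of copies.\<close>

definition power_saving :: "'a set \<Rightarrow> ('a set \<times> 'a) set \<Rightarrow> bool" where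
  "power_saving D P \<longleftrightarrow> (\<exists>c>0. \<exists>K\<ge>0. \<exists>C. \<forall>n>0. \<forall>Es\<subseteq>pointed {..<n}.
     c * (real (card Es) / (real n * 2 ^ n)) ^ C - K / real n
       \<le> real (card (copies n D P Es)) / (real n ^ card D * 2 ^ n))"

lemma finite_pointed: "finite D \<Longrightarrow> finite (pointed D)"
  by (rule finite_subset[of _ "Pow D \<times> D"]) (auto simp: pointed_def)

lemma card_pointed_le: "card (pointed {..<n}) \<le> n * 2 ^ n"
proof -
  have "card (pointed {..<n}) \<le> card (Pow {..<n} \<times> {..<n})"
    by (rule card_mono) (auto simp: pointed_def)
  then show ?thesis by (simp add: card_cartesian_product card_Pow mult.commute)
qed

lemma copies_subset: "copies n D P Es \<subseteq> Pow {..<n} \<times> (D \<rightarrow>\<^sub>E {..<n})"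
  by (auto simp: copies_def)

lemma finite_copies: "finite D \<Longrightarrow> finite (copies n D P Es)"
  by (rule finite_subset[OF copies_subset]) (simp add: finite_PiE)

lemma card_copies_le:
  assumes "finite D"
  shows "card (copies n D P Es) \<le> 2 ^ n * n ^ card D"
proof -
  have "card (copies n D P Es) \<le> card (Pow {..<n} \<times> (D \<rightarrow>\<^sub>E {..<n}))"
    by (rule card_mono[OF _ copies_subset]) (simp add: assms finite_PiE)
  then show ?thesis using assms by (simp add: card_cartesian_product card_Pow card_PiE)
qed

text \<open>Cauchy-Schwarz over the fibres of \<open>\<kappa>\<close>: their sizes add up to
  \<open>card X\<close>, and the squares of their sizes add up to the number of colliding
  pairs.\<close>

lemma card_collisions:
  assumes "finite X" "finite L" "\<kappa> ` X \<subseteq> L"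
  shows "(card X)\<^sup>2 \<le> card L * card {(a, b). a \<in> X \<and> b \<in> X \<and> \<kappa> a = \<kappa> b}"
proof -
  let ?F = "\<lambda>k. {a \<in> X. \<kappa> a = k}"
  have X: "card X = (\<Sum>k\<in>L. card (?F k))"
  proof -
    have "X = (\<Union>k\<in>L. ?F k)" using assms(3) by auto
    then have "card X = card (\<Union>k\<in>L. ?F k)" by simp
    also have "\<dots> = (\<Sum>k\<in>L. card (?F k))"
      by (rule card_UN_disjoint) (use assms in auto)
    finally show ?thesis .
  qed
  have Q: "card {(a, b). a \<in> X \<and> b \<in> X \<and> \<kappa> a = \<kappa> b} = (\<Sum>k\<in>L. (card (?F k))\<^sup>2)"
  proof -
    have "{(a, b). a \<in> X \<and> b \<in> X \<and> \<kappa> a = \<kappa> b} = (\<Union>k\<in>L. ?F k \<times> ?F k)"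
      using assms(3) by auto
    also have "card \<dots> = (\<Sum>k\<in>L. card (?F k \<times> ?F k))"
      by (rule card_UN_disjoint) (use assms in auto)
    finally show ?thesis by (simp add: card_cartesian_product power2_eq_square)
  qed
  have "(real (card X))\<^sup>2 \<le> real (card L) * (\<Sum>k\<in>L. (real (card (?F k)))\<^sup>2)"
    unfolding X of_nat_sum
    using sum_squared_le_sum_of_squares[of "\<lambda>k. real (card (?F k))" L] by (simp add: mult.commute)
  then have "real ((card X)\<^sup>2) \<le> real (card L * (\<Sum>k\<in>L. (card (?F k))\<^sup>2))" by simp
  then show ?thesis unfolding Q by (simp only: of_nat_le_iff)
qed

text \<open>Base case of two parallel edges: each \<open>(B, y)\<close> in \<open>Es\<close> is
  itself a copy, with base set \<open>B\<close> and \<open>f\<close> sent to \<open>y\<close>. Hence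
  exponent 1 and no error term.\<close>

lemma power_saving_singleton:
  assumes "P \<subseteq> {({}, f)}"
  shows "power_saving {f} P"
proof -
  have "real (card Es) / (real n * 2 ^ n) \<le>
      real (card (copies n {f} P Es)) / (real n ^ card {f} * 2 ^ n)"
    if "n > 0" and Es: "Es \<subseteq> pointed {..<n}" for n and Es :: "(nat set \<times> nat) set"
  proof -
    let ?g = "\<lambda>(B, y). (B, (\<lambda>x. if x = f then y else undefined))"
    have "inj_on ?g Es" by (auto simp: inj_on_def fun_eq_iff split: if_splits)
    moreover have "?g ` Es \<subseteq> copies n {f} P Es"
      using Es assms by (auto simp: copies_def pointed_def PiE_def extensional_def)
    ultimately have "card Es \<le> card (copies n {f} P Es)"
      by (metis card_image card_mono finite.emptyI finite.insertI finite_copies)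
    then show ?thesis by (simp add: divide_right_mono)
  qed
  then show ?thesis
    unfolding power_saving_def
    by (intro exI[of _ 1] exI[of _ 0] conjI exI[of _ "1::nat"]) auto
qed

text \<open>Two copies that agree except at \<open>f\<close> give a copy for \<open>insert g D\<close>, where \<open>g\<close> takes the second
  image of \<open>f\<close>. The second summand on the right accounts for pairs of equal copies.\<close>

lemma card_copies_duplicate:
  assumes D: "finite D" "f \<in> D" "g \<notin> D" and P': "P' \<subseteq> pointed (insert g D)"
    and P: "\<And>S x. (S, x) \<in> P' \<Longrightarrow> (g \<notin> insert x S \<and> (S, x) \<in> P) \<or>
      (f \<notin> insert x S \<and> (Transposition.transpose f g ` S, Transposition.transpose f g x) \<in> P)"
  shows "(card (copies n D P Es))\<^sup>2
    \<le> 2 ^ n * n ^ (card D - 1) * (card (copies n (insert g D) P' Es) + card (copies n D P Es))"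
proof -
  let ?X = "copies n D P Es" and ?X' = "copies n (insert g D) P' Es"
  \<comment> \<open>\<open>?\<kappa>\<close> forgets the image of \<open>f\<close>, which saves one
    power of \<open>n\<close> in \<open>?L\<close>. \<open>?h\<close> merges a colliding pair: it
    keeps the first copy and sends \<open>g\<close> to where the second copy sends
    \<open>f\<close>.\<close>
  let ?\<kappa> = "\<lambda>(A, \<phi>). (A, restrict \<phi> (D - {f}))"
  let ?L = "Pow {..<n} \<times> ((D - {f}) \<rightarrow>\<^sub>E {..<n})"
  define Q where "Q = {(a, b). a \<in> ?X \<and> b \<in> ?X \<and> ?\<kappa> a = ?\<kappa> b}"
  let ?h = "\<lambda>((A, \<phi>), (A', \<phi>')). (A, \<phi>(g := \<phi>' f))"
  have finX: "finite ?X" using D by (simp add: finite_copies)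
  have L: "card ?L = 2 ^ n * n ^ (card D - 1)"
    using D by (simp add: card_cartesian_product card_Pow card_PiE)
  have "(card ?X)\<^sup>2 \<le> card ?L * card Q"
    unfolding Q_def by (rule card_collisions[OF finX]) (use D in \<open>auto simp: copies_def finite_PiE PiE_iff\<close>)
  moreover have "card Q \<le> card ?X' + card ?X"
  proof -
    define Q1 where "Q1 = {q \<in> Q. snd (fst q) f \<noteq> snd (snd q) f}"
    define Q0 where "Q0 = {q \<in> Q. snd (fst q) f = snd (snd q) f}"
    have same: "\<phi> y = \<phi>' y"
      if "restrict \<phi> (D - {f}) = restrict \<phi>' (D - {f})" "y \<in> D" "y \<noteq> f" for \<phi> \<phi>' :: "'a \<Rightarrow> nat" and y
      using that by (metis DiffI restrict_apply' singletonD)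
    have eqD: "\<phi> = \<phi>'"
      if "\<phi> \<in> D \<rightarrow>\<^sub>E {..<n}" "\<phi>' \<in> D \<rightarrow>\<^sub>E {..<n}"
        "restrict \<phi> (D - {f}) = restrict \<phi>' (D - {f})" "\<phi> f = \<phi>' f" for \<phi> \<phi>' :: "'a \<Rightarrow> nat"
      by (rule PiE_ext[OF that(1,2)]) (metis same that(3,4))
    have "Q \<subseteq> ?X \<times> ?X" by (auto simp: Q_def)
    then have finQ: "finite Q" using finX finite_subset by blast
    have "card Q = card (Q0 \<union> Q1)" by (rule arg_cong[where f = card]) (auto simp: Q0_def Q1_def)
    also have "\<dots> \<le> card Q0 + card Q1" by (rule card_Un_le)
    finally have "card Q \<le> card Q0 + card Q1" .
    moreover have "card Q0 \<le> card ?X"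
    proof -
      have diag: "snd q = fst q" if q: "q \<in> Q0" for q
      proof -
        obtain A \<phi> B \<phi>' where "q = ((A, \<phi>), (B, \<phi>'))" by (metis surj_pair)
        moreover from this q have "A = B" "restrict \<phi> (D - {f}) = restrict \<phi>' (D - {f})" "\<phi> f = \<phi>' f"
          "\<phi> \<in> D \<rightarrow>\<^sub>E {..<n}" "\<phi>' \<in> D \<rightarrow>\<^sub>E {..<n}"
          by (simp_all add: Q0_def Q_def copies_def)
        ultimately show ?thesis using eqD[of \<phi> \<phi>'] by simp
      qed
      have "inj_on fst Q0"
      proof (rule inj_onI)
        fix p q assume pq: "p \<in> Q0" "q \<in> Q0" "fst p = fst q"
        have "snd p = snd q" unfolding diag[OF pq(1)] diag[OF pq(2)] by (rule pq(3))
        with pq(3) show "p = q" by (rule prod_eqI)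
      qed
      moreover have "fst ` Q0 \<subseteq> ?X" by (auto simp: Q0_def Q_def)
      ultimately show ?thesis using finX by (meson card_inj_on_le)
    qed
    moreover have "card Q1 \<le> card ?X'"
    proof -
      have "inj_on ?h Q1"
      proof (rule inj_onI, clarsimp simp: Q1_def Q_def, goal_cases)
        case (1 \<phi> \<phi>' \<psi> A \<psi>')
        \<comment> \<open>The merged function determines both copies: off \<open>g\<close> it is
          \<open>\<phi>\<close>, whose value at \<open>g\<close> is the default
          \<open>undefined\<close>; at \<open>g\<close> it is \<open>\<phi>' f\<close>; elsewhere on
          \<open>D\<close> the collision makes \<open>\<phi>'\<close> agree with
          \<open>\<phi>\<close>.\<close>
        have gD: "\<phi> g = undefined" "\<psi> g = undefined"
          using 1 D by (auto simp: copies_def PiE_def extensional_def)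
        have e: "\<phi> = \<psi>"
        proof
          fix y show "\<phi> y = \<psi> y" using 1 gD by (cases "y = g") (auto simp: fun_eq_iff split: if_splits)
        qed
        have f: "\<phi>' f = \<psi>' f" using 1 by (metis fun_upd_same)
        have r: "restrict \<phi>' (D - {f}) = restrict \<psi>' (D - {f})" using 1 e by simp
        have "\<phi>' \<in> D \<rightarrow>\<^sub>E {..<n}" "\<psi>' \<in> D \<rightarrow>\<^sub>E {..<n}" using 1 by (simp_all add: copies_def)
        then have "\<phi>' = \<psi>'" by (rule eqD[OF _ _ r f])
        with e show ?case by simp
      qed
      moreover have "?h ` Q1 \<subseteq> ?X'"
      proof
        fix p assume "p \<in> ?h ` Q1"
        then obtain A \<phi> \<phi>' where p: "p = (A, \<phi>(g := \<phi>' f))"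
          and 1: "(A, \<phi>) \<in> ?X" "(A, \<phi>') \<in> ?X"
            "restrict \<phi> (D - {f}) = restrict \<phi>' (D - {f})" "\<phi> f \<noteq> \<phi>' f"
          by (auto simp: Q1_def Q_def)
        let ?\<phi> = "\<phi>(g := \<phi>' f)"
        note same = same[OF 1(3)]
        have \<phi>: "A \<subseteq> {..<n}" "\<phi> \<in> D \<rightarrow>\<^sub>E {..<n}" "inj_on \<phi> D" "A \<inter> \<phi> ` D = {}"
          "\<And>S x. (S, x) \<in> P \<Longrightarrow> (A \<union> \<phi> ` S, \<phi> x) \<in> Es"
          using 1(1) by (auto simp: copies_def)
        have \<phi>': "\<phi>' \<in> D \<rightarrow>\<^sub>E {..<n}" "inj_on \<phi>' D" "A \<inter> \<phi>' ` D = {}"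
          "\<And>S x. (S, x) \<in> P \<Longrightarrow> (A \<union> \<phi>' ` S, \<phi>' x) \<in> Es"
          using 1(2) by (auto simp: copies_def)
        \<comment> \<open>At \<open>f\<close> this holds by membership in \<open>Q1\<close>; at any
          other \<open>y\<close> the two copies agree, and \<open>\<phi>'\<close> is
          injective.\<close>
        have ne: "\<phi> y \<noteq> \<phi>' f" if "y \<in> D" for y
          using that 1(4) same[of y] \<phi>'(2) D(2) by (metis inj_on_eq_iff)
        have im: "?\<phi> ` D = \<phi> ` D" using D(3) by auto
        have "?\<phi> \<in> insert g D \<rightarrow>\<^sub>E {..<n}"
          using \<phi>(2) \<phi>'(1) D(2) by (auto simp: PiE_def extensional_def)
        moreover have "inj_on ?\<phi> (insert g D)"
        proof -
          have "inj_on ?\<phi> D" using \<phi>(3) D(3) by (auto simp: inj_on_def)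
          moreover have "?\<phi> g \<notin> ?\<phi> ` D" unfolding im using ne by force
          ultimately show ?thesis using D(3) by simp
        qed
        moreover have "A \<inter> ?\<phi> ` insert g D = {}"
          using \<phi>(4) \<phi>'(3) D(2) im by auto
        \<comment> \<open>A pattern edge that misses \<open>g\<close> is realised by the first copy,
          one that misses \<open>f\<close> by the second, in which \<open>g\<close> takes over the
          role of \<open>f\<close>.\<close>
        moreover have copy: "(A \<union> ?\<phi> ` S, ?\<phi> x) \<in> Es" if Sx: "(S, x) \<in> P'" for S x
        proof -
          have S: "S \<subseteq> insert g D" "x \<in> insert g D" using Sx P' by (auto simp: pointed_def)
          from P[OF Sx] show ?thesis
          proof (elim disjE conjE)
            assume "g \<notin> insert x S" "(S, x) \<in> P"
            moreover from this have "?\<phi> ` S = \<phi> ` S" by (intro image_cong) auto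
            ultimately show ?thesis using \<phi>(5)[of S x] by auto
          next
            assume fn: "f \<notin> insert x S" and "(Transposition.transpose f g ` S, Transposition.transpose f g x) \<in> P"
            then have E: "(A \<union> \<phi>' ` Transposition.transpose f g ` S, \<phi>' (Transposition.transpose f g x)) \<in> Es"
              using \<phi>'(4) by blast
            have t: "\<phi>' (Transposition.transpose f g y) = ?\<phi> y" if "y \<in> insert g D" "y \<noteq> f" for y
              using that same[of y] by (cases "y = g") auto
            have "\<phi>' ` Transposition.transpose f g ` S = ?\<phi> ` S"
              unfolding image_image by (intro image_cong refl t) (use S(1) fn in blast)+
            moreover have "\<phi>' (Transposition.transpose f g x) = ?\<phi> x"
              by (intro t) (use S(2) fn in auto)
            ultimately show ?thesis using E by simp
          qed
        qed
        then have "\<forall>(S, x)\<in>P'. (A \<union> ?\<phi> ` S, ?\<phi> x) \<in> Es" by blast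
        ultimately show "p \<in> ?X'"
          unfolding p copies_def mem_Collect_eq case_prod_conv using \<phi>(1) by (intro conjI)
      qed
      ultimately show ?thesis using D by (meson card_inj_on_le finite_copies finite_insert)
    qed
    ultimately show ?thesis by linarith
  qed
  ultimately show ?thesis unfolding L by (meson le_trans mult_le_mono2)
qed

text \<open>The model case is an edge \<open>g\<close> parallel to \<open>f\<close>: no tree
  contains both, and exchanging them maps trees to trees. The bound for \<open>P\<close> gets
  squared, which squares \<open>c\<close> and doubles \<open>C\<close>.\<close>

lemma power_saving_parallel:
  assumes "power_saving D P"
    and D: "finite D" "f \<in> D" "g \<notin> D" and P': "P' \<subseteq> pointed (insert g D)"
    and P: "\<And>S x. (S, x) \<in> P' \<Longrightarrow> (g \<notin> insert x S \<and> (S, x) \<in> P) \<or>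
      (f \<notin> insert x S \<and> (Transposition.transpose f g ` S, Transposition.transpose f g x) \<in> P)"
  shows "power_saving (insert g D) P'"
proof -
  obtain c K C where c: "c > 0" "K \<ge> 0" and *: "\<forall>n>0. \<forall>Es\<subseteq>pointed {..<n}.
     c * (real (card Es) / (real n * 2 ^ n)) ^ C - K / real n
       \<le> real (card (copies n D P Es)) / (real n ^ card D * 2 ^ n)"
    using assms(1) unfolding power_saving_def by (elim exE conjE) (rule that)
  have "c\<^sup>2 * (real (card Es) / (real n * 2 ^ n)) ^ (2 * C) - (2 * c * K + 1) / real n
       \<le> real (card (copies n (insert g D) P' Es)) / (real n ^ card (insert g D) * 2 ^ n)"
    if n: "n > 0" and Es: "Es \<subseteq> pointed {..<n}" for n and Es :: "(nat set \<times> nat) set"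
  proof -
    obtain d where d: "card D = Suc d" using D by (metis card_0_eq empty_iff not0_implies_Suc)
    define x where "x = real (card (copies n D P Es))"
    define x' where "x' = real (card (copies n (insert g D) P' Es))"
    \<comment> \<open>\<open>N * real n\<close> normalises the copies over \<open>D\<close>, with
      one more factor \<open>real n\<close> for \<open>insert g D\<close>; \<open>t\<close> is the
      density of the former.\<close>
    define N where "N = real n ^ d * 2 ^ n"
    define \<delta> where "\<delta> = real (card Es) / (real n * 2 ^ n)"
    define t where "t = x / (N * real n)"
    have N: "N > 0" using n by (simp add: N_def)
    have "card Es \<le> n * 2 ^ n"
      using card_mono[OF finite_pointed Es] card_pointed_le[of n] by fastforce
    then have "real (card Es) \<le> real n * 2 ^ n" by (metis of_nat_le_iff of_nat_mult of_nat_numeral of_nat_power)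
    then have \<delta>: "0 \<le> \<delta>" "\<delta> \<le> 1" using n by (auto simp: \<delta>_def divide_le_eq)
    have "real ((card (copies n D P Es))\<^sup>2) \<le> real (2 ^ n * n ^ (card D - 1) * (card (copies n (insert g D) P' Es) + card (copies n D P Es)))"
      using card_copies_duplicate[OF D P' P] by (rule of_nat_mono)
    then have x: "x\<^sup>2 \<le> N * (x' + x)"
      by (simp add: x_def x'_def N_def d algebra_simps)
    have xN: "x \<le> N * real n"
    proof -
      have "x \<le> real (2 ^ n * n ^ card D)"
        unfolding x_def using card_copies_le[OF D(1)] by (rule of_nat_mono)
      then show ?thesis by (simp add: N_def d algebra_simps)
    qed
    have t: "t * (N * real n) = x" using N n by (simp add: t_def)
    \<comment> \<open>Replacing the diagonal term \<open>x\<close> by its trivial bound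
      \<open>N * real n\<close> costs only \<open>1 / real n\<close> after normalisation.\<close>
    have t': "t\<^sup>2 - 1 / real n \<le> x' / (N * (real n)\<^sup>2)"
    proof -
      have "N * (x' + x) \<le> N * (x' + N * real n)"
        using xN N by (intro mult_left_mono add_left_mono) auto
      with x have "x\<^sup>2 \<le> N * (x' + N * real n)" by (rule order_trans)
      then have "N * (t\<^sup>2 * N * (real n)\<^sup>2) \<le> N * (x' + N * real n)"
        unfolding t[symmetric] by (simp add: power2_eq_square algebra_simps)
      then have "t\<^sup>2 * N * (real n)\<^sup>2 \<le> x' + N * real n" using N by simp
      then have "(t\<^sup>2 - 1 / real n) * (N * (real n)\<^sup>2) \<le> x'"
        using n by (simp add: algebra_simps power2_eq_square)
      then show ?thesis using N n by (simp add: pos_le_divide_eq)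
    qed
    define a where "a = c * \<delta> ^ C"
    define b where "b = K / real n"
    have a: "0 \<le> a" "a \<le> c" using \<delta> c by (auto simp: a_def power_le_one mult_left_le)
    have b: "0 \<le> b" using c by (simp add: b_def)
    have "a - b \<le> t" using *[rule_format, OF n Es] by (simp add: a_def b_def \<delta>_def t_def x_def N_def d mult_ac)
    \<comment> \<open>As \<open>a - b\<close> may be negative, \<open>a - b \<le> t\<close> is not
      squared directly. Multiplying by \<open>2 * a\<close> and using that \<open>2 * a * t\<close>
      is at most the sum of the squares of \<open>a\<close> and \<open>t\<close> works for either
      sign.\<close>
    then have "2 * a * (a - b) \<le> 2 * a * t" using a by (intro mult_left_mono) auto
    moreover have "2 * a * t \<le> a\<^sup>2 + t\<^sup>2" using sum_squares_bound[of a t] by simp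
    moreover have "a * b \<le> c * b" using a b by (intro mult_right_mono)
    ultimately have "a\<^sup>2 - 2 * (c * b) \<le> t\<^sup>2" by (simp add: algebra_simps power2_eq_square)
    then have "a\<^sup>2 - 2 * (c * b) - 1 / real n \<le> x' / (N * (real n)\<^sup>2)" using t' by linarith
    moreover have "a\<^sup>2 = c\<^sup>2 * \<delta> ^ (2 * C)"
      by (simp add: a_def power_mult_distrib mult.commute[of 2] power_mult)
    moreover have "2 * (c * b) + 1 / real n = (2 * c * K + 1) / real n"
      by (simp add: b_def add_divide_distrib)
    moreover have "N * (real n)\<^sup>2 = real n ^ card (insert g D) * 2 ^ n"
      using D d by (simp add: N_def power2_eq_square)
    ultimately show ?thesis by (simp add: \<delta>_def x'_def)
  qed
  then show ?thesis unfolding power_saving_def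
    using c by (intro exI[of _ "c\<^sup>2"] exI[of _ "2 * c * K + 1"] conjI exI[of _ "2 * C"]) auto
qed

section \<open>Complementation in the cube and series extensions\<close>

definition dual :: "'a set \<Rightarrow> ('a set \<times> 'a) set \<Rightarrow> ('a set \<times> 'a) set" where
  "dual D P = (\<lambda>(S, x). (D - insert x S, x)) ` P"

lemma dual_subset_pointed: "P \<subseteq> pointed D \<Longrightarrow> dual D P \<subseteq> pointed D"
  by (auto simp: dual_def pointed_def)

lemma dual_dual:
  assumes "P \<subseteq> pointed D" shows "dual D (dual D P) = P"
proof -
  have "(\<lambda>(S, x). (D - insert x (D - insert x S), x)) ` P = (\<lambda>p. p) ` P"
    by (rule image_cong) (use assms in \<open>auto simp: pointed_def\<close>)
  then show ?thesis by (simp add: dual_def image_image case_prod_unfold)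
qed

lemma card_dual:
  assumes "P \<subseteq> pointed D" shows "card (dual D P) = card P"
  unfolding dual_def
  by (rule card_image) (use assms in \<open>auto simp: pointed_def inj_on_def\<close>)

text \<open>Complementation turns a cube edge upside down, so \<open>S\<close> becomes
  \<open>D - insert x S\<close>; on exchange pairs this is matroid duality. Complementing only the
  fixed coordinates of a copy of \<open>P\<close> in the complemented host gives a copy of the dual
  pattern in \<open>Es\<close>, with the same constants.\<close>

lemma power_saving_dual:
  assumes "power_saving D P" "finite D" "P \<subseteq> pointed D"
  shows "power_saving D (dual D P)"
proof -
  have le: "card (copies n D P (dual {..<n} Es)) \<le> card (copies n D (dual D P) Es)"
    if Es: "Es \<subseteq> pointed {..<n}" for n Es
  proof (rule card_inj_on_le)
    let ?h = "\<lambda>(A, \<phi>). ({..<n} - A - \<phi> ` D, \<phi>)"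
    show "inj_on ?h (copies n D P (dual {..<n} Es))"
      by (rule inj_onI) (auto simp: copies_def; blast)
    show "finite (copies n D (dual D P) Es)" using assms by (simp add: finite_copies)
    show "?h ` copies n D P (dual {..<n} Es) \<subseteq> copies n D (dual D P) Es"
    proof (clarsimp, goal_cases)
      case (1 A \<phi>)
      then have \<phi>: "A \<subseteq> {..<n}" "\<phi> \<in> D \<rightarrow>\<^sub>E {..<n}" "inj_on \<phi> D" "A \<inter> \<phi> ` D = {}"
        "\<And>S x. (S, x) \<in> P \<Longrightarrow> (A \<union> \<phi> ` S, \<phi> x) \<in> dual {..<n} Es"
        by (auto simp: copies_def)
      have "({..<n} - A - \<phi> ` D \<union> \<phi> ` (D - insert x S), \<phi> x) \<in> Es" if "(S, x) \<in> P" for S x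
      proof -
        have Sx: "S \<subseteq> D" "x \<in> D" "x \<notin> S" using that assms(3) by (auto simp: pointed_def)
        have im: "\<phi> ` (D - insert x S) = \<phi> ` D - insert (\<phi> x) (\<phi> ` S)"
          using \<phi>(3) Sx by (auto simp: inj_on_def)
        have "\<phi> ` D \<subseteq> {..<n}" using \<phi>(2) by auto
        then have *: "{..<n} - A - \<phi> ` D \<union> \<phi> ` (D - insert x S) = {..<n} - insert (\<phi> x) (A \<union> \<phi> ` S)"
          unfolding im using Sx \<phi>(4) by auto
        from \<phi>(5)[OF that] have "({..<n} - insert (\<phi> x) (A \<union> \<phi> ` S), \<phi> x) \<in> dual {..<n} (dual {..<n} Es)"
          unfolding dual_def[of _ "dual _ _"] by force
        then show ?thesis unfolding * using dual_dual[OF Es] by simp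
      qed
      then show ?case using \<phi> by (auto simp: copies_def dual_def)
    qed
  qed
  obtain c K C where c: "c > 0" "K \<ge> 0" and *: "\<forall>n>0. \<forall>Es\<subseteq>pointed {..<n}.
     c * (real (card Es) / (real n * 2 ^ n)) ^ C - K / real n
       \<le> real (card (copies n D P Es)) / (real n ^ card D * 2 ^ n)"
    using assms(1) unfolding power_saving_def by (elim exE conjE) (rule that)
  have "c * (real (card Es) / (real n * 2 ^ n)) ^ C - K / real n
       \<le> real (card (copies n D (dual D P) Es)) / (real n ^ card D * 2 ^ n)"
    if n: "n > 0" and Es: "Es \<subseteq> pointed {..<n}" for n and Es :: "(nat set \<times> nat) set"
  proof -
    have "c * (real (card Es) / (real n * 2 ^ n)) ^ C - K / real n
       \<le> real (card (copies n D P (dual {..<n} Es))) / (real n ^ card D * 2 ^ n)"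
      using *[rule_format, OF n dual_subset_pointed[OF Es]] by (simp only: card_dual[OF Es])
    also have "\<dots> \<le> real (card (copies n D (dual D P) Es)) / (real n ^ card D * 2 ^ n)"
      using le[OF Es] by (intro divide_right_mono) auto
    finally show ?thesis .
  qed
  then show ?thesis unfolding power_saving_def
    using c by (intro exI[of _ c] exI[of _ K] conjI exI[of _ C]) auto
qed

text \<open>This is \<open>power_saving_parallel\<close> between two complementations: sets
  containing \<open>g\<close> become sets avoiding it. In the model case \<open>f\<close> and
  \<open>g\<close> are the two edges at a vertex of degree 2, so that every \<open>S\<close>
  contains one of them and that edge can be contracted.\<close>

lemma power_saving_series:
  assumes "power_saving D P" and PD: "P \<subseteq> pointed D"
    and D: "finite D" "f \<in> D" "g \<notin> D" and P': "P' \<subseteq> pointed (insert g D)"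
    and P: "\<And>S x. (S, x) \<in> P' \<Longrightarrow> (g \<in> S \<and> (S - {g}, x) \<in> P) \<or>
      (f \<in> S \<and> (Transposition.transpose f g ` S - {g}, Transposition.transpose f g x) \<in> P)"
  shows "power_saving (insert g D) P'"
proof -
  have "power_saving (insert g D) (dual (insert g D) P')"
  proof (rule power_saving_parallel[OF power_saving_dual[OF assms(1) D(1) PD] D dual_subset_pointed[OF P']])
    fix T x assume "(T, x) \<in> dual (insert g D) P'"
    then obtain S where Sx: "(S, x) \<in> P'" and T: "T = insert g D - insert x S"
      by (auto simp: dual_def)
    have S: "S \<subseteq> insert g D" "x \<in> insert g D" "x \<notin> S" using Sx P' by (auto simp: pointed_def)
    let ?t = "Transposition.transpose f g"
    from P[OF Sx] show "(g \<notin> insert x T \<and> (T, x) \<in> dual D P) \<or>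
      (f \<notin> insert x T \<and> (?t ` T, ?t x) \<in> dual D P)"
    proof (elim disjE conjE)
      assume g: "g \<in> S" and p: "(S - {g}, x) \<in> P"
      have "T = D - insert x (S - {g})" using T g D by auto
      then have "(T, x) \<in> dual D P" using p by (force simp: dual_def)
      then show ?thesis using g S T by auto
    next
      assume f: "f \<in> S" and p: "(?t ` S - {g}, ?t x) \<in> P"
      have "?t ` insert g D = insert g D" using D by (intro transpose_image_eq) auto
      then have "?t ` T = insert g D - insert (?t x) (?t ` S)"
        unfolding T by (subst image_set_diff) auto
      moreover have "g \<in> ?t ` S" using f by (metis image_eqI transpose_apply_first)
      ultimately have "?t ` T = D - insert (?t x) (?t ` S - {g})" using D by auto
      then have "(?t ` T, ?t x) \<in> dual D P" using p by (force simp: dual_def)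
      then show ?thesis using f S T by auto
    qed
  qed
  then have "power_saving (insert g D) (dual (insert g D) (dual (insert g D) P'))"
    by (rule power_saving_dual) (use D dual_subset_pointed[OF P'] in auto)
  then show ?thesis using dual_dual[OF P'] by simp
qed

section \<open>Degree conditions that force a K4 minor\<close>

section \<open>Vertices of small degree in graphs without a K4 minor\<close>

text \<open>The four branch sets are the fibres of \<open>c\<close> over \<open>0, \<dots>, 3\<close>; vertices with a larger value of \<open>c\<close>
  are unused.\<close>

definition k4_model :: "'v set \<Rightarrow> ('v \<times> 'v) set \<Rightarrow> ('v \<Rightarrow> nat) \<Rightarrow> bool" where
  "k4_model V R c \<longleftrightarrow>
     (\<forall>i<4. \<exists>v\<in>V. c v = i) \<and>
     (\<forall>u\<in>V. \<forall>v\<in>V. c u = c v \<longrightarrow> c v < 4 \<longrightarrow> (u, v) \<in> (Restr R {w \<in> V. c w = c v})\<^sup>*) \<and>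
     (\<forall>i<4. \<forall>j<4. i \<noteq> j \<longrightarrow> (\<exists>u\<in>V. \<exists>v\<in>V. c u = i \<and> c v = j \<and> (u, v) \<in> R))"

definition nbrs :: "'v set \<Rightarrow> ('v \<times> 'v) set \<Rightarrow> 'v \<Rightarrow> 'v set" where
  "nbrs V R x = {y \<in> V. (x, y) \<in> R \<and> y \<noteq> x}"

text \<open>Vertices outside \<open>V\<close> get the value 4 and so join no branch set.\<close>

lemma k4_model_mono:
  assumes "k4_model V R c" "V \<subseteq> W" "R \<subseteq> Q"
  shows "k4_model W Q (\<lambda>v. if v \<in> V then c v else 4)"
  unfolding k4_model_def
proof (intro conjI allI ballI impI)
  fix i :: nat assume "i < 4"
  then show "\<exists>v\<in>W. (if v \<in> V then c v else 4) = i"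
    using assms unfolding k4_model_def by fastforce
next
  fix i j :: nat assume "i < 4" "j < 4" "i \<noteq> j"
  then obtain u v where "u \<in> V" "v \<in> V" "c u = i" "c v = j" "(u, v) \<in> R"
    using assms unfolding k4_model_def by blast
  then show "\<exists>u\<in>W. \<exists>v\<in>W. (if u \<in> V then c u else 4) = i \<and> (if v \<in> V then c v else 4) = j \<and> (u, v) \<in> Q"
    using assms by (intro bexI[of _ u] bexI[of _ v]) auto
next
  let ?c = "\<lambda>v. if v \<in> V then c v else 4"
  fix u v assume uv: "u \<in> W" "v \<in> W" "?c u = ?c v" "?c v < 4"
  then have V: "u \<in> V" "v \<in> V" "c u = c v" "c v < 4" by (auto split: if_splits)
  then have "(u, v) \<in> (Restr R {w \<in> V. c w = c v})\<^sup>*" using assms(1) unfolding k4_model_def by blast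
  moreover have "Restr R {w \<in> V. c w = c v} \<subseteq> Restr Q {w \<in> W. ?c w = ?c v}"
    using assms V by auto
  ultimately show "(u, v) \<in> (Restr Q {w \<in> W. ?c w = ?c v})\<^sup>*"
    by (meson rtrancl_mono subsetD)
qed

text \<open>A model of the contracted graph pulls back: \<open>x\<close> joins the class of
  \<open>y\<close>, and the edge between them keeps that class connected.\<close>

lemma k4_model_contract:
  assumes m: "k4_model (V - {x}) (map_prod (id(x := y)) (id(x := y)) ` R) c"
    and V: "x \<in> V" "y \<in> V" "x \<noteq> y" and R: "R \<subseteq> V \<times> V" "(x, y) \<in> R" "(y, x) \<in> R"
  shows "k4_model V R (c \<circ> id(x := y))"
proof -
  define h where "h = id(x := y)"
  define Q where "Q = map_prod h h ` R"
  define T where "T k = Restr R {w \<in> V. c (h w) = k}" for k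
  have mQ: "k4_model (V - {x}) Q c" unfolding Q_def h_def by (rule m)
  have h: "h x = y" "h y = y" "\<And>v. v \<noteq> x \<Longrightarrow> h v = v" by (auto simp: h_def)
  have hV: "h v \<in> V - {x}" if "v \<in> V" for v using that V by (auto simp: h_def)
  have xy: "(x, y) \<in> (T (c y))\<^sup>*" "(y, x) \<in> (T (c y))\<^sup>*"
    using R V h by (auto intro!: r_into_rtrancl simp: T_def)
  have fib: "(p, q) \<in> (T (c (h q)))\<^sup>*" if "h p = h q" for p q
  proof (cases "p = q")
    case False
    then have "p = x \<and> q = y \<or> p = y \<and> q = x" using that h by metis
    then show ?thesis using xy h by metis
  qed simp
  \<comment> \<open>Each edge of the contracted path has a preimage in \<open>R\<close>. Consecutive
    preimages need not meet, but their ends have the same image under \<open>h\<close>, so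
    \<open>fib\<close> joins them inside the class.\<close>
  have lift: "(p, q) \<in> (T k)\<^sup>*"
    if "(a, b) \<in> (Restr Q {w \<in> V - {x}. c w = k})\<^sup>*" "h p = a" "h q = b" "c b = k"
    for a b p q k
    using that
  proof (induction arbitrary: q rule: rtrancl_induct)
    case base
    then show ?case using fib[of p q] by simp
  next
    case (step b' b)
    then obtain r s where rs: "(r, s) \<in> R" "h r = b'" "h s = b" by (auto simp: Q_def)
    have "c b' = k" using step.hyps(2) by simp
    then have "(p, r) \<in> (T k)\<^sup>*" using step.IH[of r] step.prems(1) rs(2) by blast
    moreover have "(r, s) \<in> T k"
      using rs R(1) \<open>c b' = k\<close> step.prems(3) by (auto simp: T_def)
    moreover have "(s, q) \<in> (T k)\<^sup>*"
      using fib[of s q] step.prems(2,3) rs(3) by simp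
    ultimately show ?case by (meson rtrancl.rtrancl_into_rtrancl rtrancl_trans)
  qed
  have "k4_model V R (c \<circ> h)"
    unfolding k4_model_def o_apply
  proof (intro conjI allI ballI impI)
    fix i :: nat assume "i < 4"
    then obtain v where "v \<in> V - {x}" "c v = i" using mQ unfolding k4_model_def by blast
    then show "\<exists>v\<in>V. c (h v) = i" using h(3) by (intro bexI[of _ v]) auto
  next
    fix i j :: nat assume "i < 4" "j < 4" "i \<noteq> j"
    then obtain u v where uv: "c u = i" "c v = j" "(u, v) \<in> Q"
      using mQ unfolding k4_model_def by blast
    then obtain r s where "(r, s) \<in> R" "h r = u" "h s = v" by (auto simp: Q_def)
    then show "\<exists>u\<in>V. \<exists>v\<in>V. c (h u) = i \<and> c (h v) = j \<and> (u, v) \<in> R"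
      using R(1) uv by (intro bexI[of _ r] bexI[of _ s]) auto
  next
    fix u v assume uv: "u \<in> V" "v \<in> V" "c (h u) = c (h v)" "c (h v) < 4"
    then have "(h u, h v) \<in> (Restr Q {w \<in> V - {x}. c w = c (h v)})\<^sup>*"
      using mQ hV[OF uv(1)] hV[OF uv(2)] unfolding k4_model_def by blast
    then have "(u, v) \<in> (T (c (h v)))\<^sup>*" by (rule lift) simp_all
    then show "(u, v) \<in> (Restr R {w \<in> V. c (h w) = c (h v)})\<^sup>*" by (simp only: T_def)
  qed
  then show ?thesis by (simp only: h_def)
qed

text \<open>The branch sets are \<open>{p}\<close>, \<open>{q}\<close>, \<open>{y}\<close> and the
  component \<open>Z\<close> of \<open>w\<close> after removal of these three vertices. The two
  neighbourhoods supply five of the six adjacencies, and the edge from \<open>z\<close> to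
  \<open>y\<close> the sixth.\<close>

lemma k4_model_twins:
  assumes R: "sym R" and pq: "p \<in> V" "q \<in> V" "p \<noteq> q"
    and N: "nbrs V R p = {q, y, w}" "nbrs V R q = {p, y, w}" "y \<noteq> w"
    and Z: "Z = {z. (w, z) \<in> (Restr R (V - {p, q, y}))\<^sup>*}" and a: "z \<in> Z" "(z, y) \<in> R"
  shows "\<exists>c. k4_model V R c"
proof -
  have y: "y \<in> V" "y \<noteq> p" "y \<noteq> q" "(p, y) \<in> R" "(q, y) \<in> R"
    and w: "w \<in> V" "w \<noteq> p" "w \<noteq> q" "(p, w) \<in> R" "(q, w) \<in> R" and pqR: "(p, q) \<in> R"
    using N by (auto simp: nbrs_def)
  have s: "(v, u) \<in> R" if "(u, v) \<in> R" for u v using that R by (auto dest: symD)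
  have wZ: "w \<in> Z" by (simp add: Z)
  have ZV: "Z \<subseteq> V - {p, q, y}"
  proof
    fix v assume "v \<in> Z"
    then have "(w, v) \<in> (Restr R (V - {p, q, y}))\<^sup>*" by (simp add: Z)
    then show "v \<in> V - {p, q, y}" by (induction rule: rtrancl_induct) (use w N(3) in auto)
  qed
  define c where "c = (\<lambda>v. if v = p then 0 else if v = q then 1 else if v = y then 2 else if v \<in> Z then 3 else (4::nat))"
  have con: "(w, v) \<in> (Restr R Z)\<^sup>*" if "v \<in> Z" for v
  proof -
    have "(w, v) \<in> (Restr R (V - {p, q, y}))\<^sup>*" using that by (simp add: Z)
    then show ?thesis
    proof (induction rule: rtrancl_induct)
      case (step u v)
      have "(w, v) \<in> (Restr R (V - {p, q, y}))\<^sup>*" using step by (meson rtrancl.rtrancl_into_rtrancl)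
      then have "u \<in> Z" "v \<in> Z" using step by (auto simp: Z)
      then show ?case using step by (meson IntI SigmaI IntD1 rtrancl.rtrancl_into_rtrancl)
    qed simp
  qed
  have "sym ((Restr R Z)\<^sup>*)" using R by (intro sym_rtrancl) (auto simp: sym_def)
  then have con2: "(u, v) \<in> (Restr R Z)\<^sup>*" if "u \<in> Z" "v \<in> Z" for u v
    using con that by (meson rtrancl_trans symD)
  have fibre: "{u \<in> V. c u = 3} = Z" using ZV by (auto simp: c_def split: if_splits)
  have cv: "c p = 0" "c q = 1" "c y = 2" "c w = 3" "c z = 3" "z \<in> V"
    using pq y wZ a ZV by (auto simp: c_def)
  have "k4_model V R c"
    unfolding k4_model_def
  proof (intro conjI allI ballI impI)
    fix i :: nat assume "i < 4"
    then have "i = 0 \<or> i = 1 \<or> i = 2 \<or> i = 3" by auto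
    then show "\<exists>v\<in>V. c v = i"
      using pq(1,2) y(1) w(1) cv by metis
  next
    have "\<exists>u\<in>V. \<exists>v\<in>V. c u = i \<and> c v = j \<and> (u, v) \<in> R" if "i < j" "j < 4" for i j
    proof -
      have "i = 0 \<and> j = 1 \<or> i = 0 \<and> j = 2 \<or> i = 0 \<and> j = 3 \<or> i = 1 \<and> j = 2 \<or> i = 1 \<and> j = 3 \<or> i = 2 \<and> j = 3"
        using that by auto
      then show ?thesis using cv pqR y(1,4,5) w(1,4,5) s[OF a(2)] pq(1,2) by metis
    qed
    then have *: "\<And>i j. i < j \<Longrightarrow> j < 4 \<Longrightarrow> \<exists>u\<in>V. \<exists>v\<in>V. c u = i \<and> c v = j \<and> (u, v) \<in> R" .
    fix i j :: nat assume "i < 4" "j < 4" "i \<noteq> j"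
    with * show "\<exists>u\<in>V. \<exists>v\<in>V. c u = i \<and> c v = j \<and> (u, v) \<in> R"
      using s by (metis linorder_neqE_nat)
  next
    fix u v assume uv: "u \<in> V" "v \<in> V" "c u = c v" "c v < 4"
    show "(u, v) \<in> (Restr R {w \<in> V. c w = c v})\<^sup>*"
    proof (cases "c v = 3")
      case True
      then have "u \<in> Z" "v \<in> Z" using uv by (auto simp: c_def split: if_splits)
      then show ?thesis unfolding True fibre using con2 by blast
    next
      case False
      then have "u = v" using uv by (auto simp: c_def split: if_splits)
      then show ?thesis by simp
    qed
  qed
  then show ?thesis by blast
qed

lemma card3_obtain:
  assumes "card A = 3" "x \<in> A" "y \<in> A" "x \<noteq> y"
  obtains w where "A = {x, y, w}" "w \<noteq> x" "w \<noteq> y"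
proof -
  have "finite A" using assms(1) card.infinite by fastforce
  then have "card (A - {x, y}) = 1" using assms by (simp add: card_Diff_subset)
  then obtain w where "A - {x, y} = {w}" by (auto simp: card_1_singleton_iff)
  then have "A = {x, y, w}" "w \<noteq> x" "w \<noteq> y" using assms by auto
  then show ?thesis by (rule that)
qed

lemma nbrs_sym: "sym R \<Longrightarrow> x \<in> V \<Longrightarrow> y \<in> nbrs V R x \<Longrightarrow> x \<in> nbrs V R y"
  by (auto simp: nbrs_def dest: symD)

lemma finite_nbrs: "finite V \<Longrightarrow> finite (nbrs V R x)"
  by (simp add: nbrs_def)

text \<open>Dirac's theorem that minimum degree 3 forces a K4 minor, with the ends of one edge
  exempted from the degree condition. The exemption spares \<open>e\<close> in the application, and
  in the induction it covers the attachment vertex of a separated part.\<close>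

lemma k4_model_if_degree_ge_3:
  assumes "finite V" "sym R" "R \<subseteq> V \<times> V" "(s, t) \<in> R" "s \<noteq> t" "3 \<le> card V"
    and "\<And>x. x \<in> V - {s, t} \<Longrightarrow> 3 \<le> card (nbrs V R x)"
  shows "\<exists>c. k4_model V R c"
  using assms
proof (induction "card V" arbitrary: V R s t rule: less_induct)
  case less
  note fin = less.prems(1) and symR = less.prems(2) and RV = less.prems(3) and st = less.prems(4,5)
    and cV = less.prems(6) and deg = less.prems(7)
  have finN: "finite (nbrs V R x)" for x using fin by (rule finite_nbrs)
  have twins: "\<exists>c. k4_model V R c"
    if p: "p \<in> V - {s, t}" and q: "q \<in> V - {s, t}" and pq: "p \<noteq> q"
      and N: "nbrs V R p = {q, y, w}" "nbrs V R q = {p, y, w}" and yw: "y \<noteq> w" for p q y w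
  proof -
    define Z where "Z = {z. (w, z) \<in> (Restr R (V - {p, q, y}))\<^sup>*}"
    show ?thesis
    proof (cases "\<exists>z\<in>Z. (z, y) \<in> R")
      case True
      then show ?thesis
        using k4_model_twins[OF symR _ _ pq N yw Z_def] p q by blast
    next
      case False
      \<comment> \<open>Now \<open>{p, q}\<close> separates \<open>Z\<close> from the side of
        \<open>y\<close>, with \<open>w\<close> and \<open>y\<close> as the only attachment vertices
        on the two sides.\<close>
      then have nZy: "\<And>z. z \<in> Z \<Longrightarrow> (z, y) \<notin> R" by blast
      have w: "w \<in> V - {p, q, y}" and y: "y \<in> V - {p, q}" using N yw by (auto simp: nbrs_def)
      have ZV: "Z \<subseteq> V - {p, q, y}"
      proof
        fix v assume "v \<in> Z"
        then have "(w, v) \<in> (Restr R (V - {p, q, y}))\<^sup>*" by (simp add: Z_def)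
        then show "v \<in> V - {p, q, y}" by (induction rule: rtrancl_induct) (use w in auto)
      qed
      have wZ: "w \<in> Z" by (simp add: Z_def)
      have cl: "v \<in> Z" if "u \<in> Z" "(u, v) \<in> R" "v \<in> V - {p, q, y}" for u v
      proof -
        have "(u, v) \<in> Restr R (V - {p, q, y})" using that ZV by blast
        then show ?thesis using that(1) unfolding Z_def mem_Collect_eq by (rule rtrancl.rtrancl_into_rtrancl[rotated])
      qed
      have adj_pq: "u = y \<or> u = w" if "v \<in> {p, q}" "(u, v) \<in> R" "u \<in> V - {p, q}" for u v
      proof -
        have "u \<in> nbrs V R v" using that symR by (auto simp: nbrs_def dest: symD)
        then show ?thesis using that N by auto
      qed
      \<comment> \<open>A side \<open>X\<close> attached at \<open>a\<close> only and otherwise free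
        of \<open>s\<close> and \<open>t\<close> is a smaller instance. Degree 3 gives
        \<open>a\<close> a neighbour \<open>b\<close> inside \<open>X\<close>, and the edge from
        \<open>a\<close> to \<open>b\<close> takes the place of the exempted edge; all other
        vertices of \<open>X\<close> keep their neighbourhoods.\<close>
      have sub: "\<exists>c. k4_model V R c"
        if X: "X \<subseteq> V - {p, q}" "a \<in> X" "a \<notin> {s, t}" "nbrs V R a \<subseteq> X \<union> {p, q}"
          and X': "\<And>z. z \<in> X - {a} \<Longrightarrow> z \<notin> {s, t} \<and> nbrs V R z \<subseteq> X" for X a
      proof -
        have "card {p, q} < card (nbrs V R a)" using deg[of a] X pq by auto
        then have "\<not> nbrs V R a \<subseteq> {p, q}" by (metis card_mono finite.emptyI finite.insertI leD)
        then obtain b where b: "b \<in> nbrs V R a" "b \<in> X" using X by blast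
        then have ab: "(a, b) \<in> R" "b \<noteq> a" by (auto simp: nbrs_def)
        have XV: "X \<subset> V" using X p by auto
        then have finX: "finite X" "card X < card V" using fin finite_subset psubset_card_mono by blast+
        have bN: "b \<notin> {s, t}" "nbrs V R b \<subseteq> X" using X'[of b] b ab by auto
        have "3 \<le> card (nbrs V R b)" using deg[of b] bN b XV by blast
        also have "\<dots> \<le> card X" using bN finX by (simp add: card_mono)
        finally have cX: "3 \<le> card X" .
        have "\<exists>c. k4_model X (Restr R X) c"
        proof (rule less.hyps[OF finX(2,1), of _ a b])
          show "sym (Restr R X)" using symR by (auto simp: sym_def)
          show "(a, b) \<in> Restr R X" using ab b X by auto
          show "3 \<le> card (nbrs X (Restr R X) z)" if "z \<in> X - {a, b}" for z
          proof -
            have "nbrs X (Restr R X) z = nbrs V R z" using X'[of z] that XV by (auto simp: nbrs_def)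
            moreover have "z \<in> V - {s, t}" using X'[of z] that XV by auto
            ultimately show ?thesis using deg by simp
          qed
        qed (use ab cX in auto)
        then show ?thesis using k4_model_mono[of X _ _ V R] XV by blast
      qed
      have nZ: "nbrs V R z \<subseteq> Z" if "z \<in> Z - {w}" for z
      proof
        fix v assume v: "v \<in> nbrs V R z"
        then have zv: "(z, v) \<in> R" "v \<in> V" by (auto simp: nbrs_def)
        have "v \<noteq> y" using nZy[of z] that zv by auto
        moreover have "v \<notin> {p, q}" using adj_pq[OF _ zv(1)] that ZV by auto
        ultimately show "v \<in> Z" using cl[OF _ zv(1)] that zv by auto
      qed
      \<comment> \<open>Being adjacent, \<open>s\<close> and \<open>t\<close> cannot lie on
        different sides of the separation; the side without them is the smaller instance.\<close>
      show ?thesis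
      proof (cases "s \<in> Z \<or> t \<in> Z")
        case False
        show ?thesis
        proof (rule sub[of Z w])
          show "nbrs V R w \<subseteq> Z \<union> {p, q}"
            using cl[OF wZ] nZy[OF wZ] by (auto simp: nbrs_def)
        qed (use ZV wZ nZ False in auto)
      next
        case True
        have ts: "(t, s) \<in> R" using st symR by (auto dest: symD)
        have st_pq: "s \<in> V - {p, q}" "t \<in> V - {p, q}" using st RV p q by auto
        have stZ: "s \<in> Z" "t \<in> Z"
          using True cl[OF _ st(1)] cl[OF _ ts] st_pq nZy st(1) ts by blast+
        show ?thesis
        proof (rule sub[of "V - {p, q} - Z" y])
          show "nbrs V R y \<subseteq> V - {p, q} - Z \<union> {p, q}"
            using nZy symR by (auto simp: nbrs_def dest: symD)
          show "z \<notin> {s, t} \<and> nbrs V R z \<subseteq> V - {p, q} - Z" if z: "z \<in> V - {p, q} - Z - {y}" for z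
          proof -
            have "v \<notin> Z \<and> v \<notin> {p, q}" if "v \<in> nbrs V R z" for v
            proof -
              have vz: "(v, z) \<in> R" "(z, v) \<in> R" using that symR by (auto simp: nbrs_def dest: symD)
              show ?thesis using cl[OF _ vz(1)] adj_pq[OF _ vz(2)] z wZ by auto
            qed
            then show ?thesis using z stZ by (auto simp: nbrs_def)
          qed
        qed (use y stZ ZV in auto)
      qed
    qed
  qed
  show ?case
  proof (rule ccontr)
    assume no: "\<nexists>c. k4_model V R c"
    \<comment> \<open>Contract \<open>x\<close> into \<open>y\<close>. The smaller graph has no
      model, so its degree condition must fail. A vertex other than \<open>y\<close> loses a
      neighbour only if it is adjacent to both \<open>x\<close> and \<open>y\<close>, and then just
      one, so some such vertex had degree exactly 3.\<close>
    have common: "\<exists>z\<in>V - {s, t}. z \<noteq> x \<and> z \<noteq> y \<and> x \<in> nbrs V R z \<and> y \<in> nbrs V R z \<and> card (nbrs V R z) = 3"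
      if x: "x \<in> V - {s, t}" and y: "y \<in> nbrs V R x" for x y
    proof (rule ccontr)
      assume none: "\<not> ?thesis"
      define h where "h = id(x := y)"
      let ?R = "map_prod h h ` R"
      have h: "h x = y" "h y = y" "\<And>v. v \<noteq> x \<Longrightarrow> h v = v" by (auto simp: h_def)
      have xy: "(x, y) \<in> R" "(y, x) \<in> R" "y \<in> V" "y \<noteq> x"
        using y symR by (auto simp: nbrs_def dest: symD)
      have "\<exists>c. k4_model (V - {x}) ?R c"
      proof (rule less.hyps[of _ _ s t])
        show "card (V - {x}) < card V" using fin x by (intro psubset_card_mono) auto
        show "finite (V - {x})" using fin by simp
        show "sym ?R" using symR by (fastforce simp: sym_def)
        show "?R \<subseteq> (V - {x}) \<times> (V - {x})" using RV xy by (auto simp: h_def split: if_splits)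
        show "(s, t) \<in> ?R" using st x h(3)[of s] h(3)[of t] by force
        show "s \<noteq> t" by (rule st)
        have "nbrs V R x \<subseteq> V - {x}" by (auto simp: nbrs_def)
        then have "card (nbrs V R x) \<le> card (V - {x})" using fin by (intro card_mono) auto
        then show "3 \<le> card (V - {x})" using deg[OF x] by linarith
        fix v assume v: "v \<in> V - {x} - {s, t}"
        have fN: "finite (nbrs (V - {x}) ?R v)" using fin by (simp add: finite_nbrs)
        show "3 \<le> card (nbrs (V - {x}) ?R v)"
        proof (cases "v = y")
          case False
          have sub: "h ` nbrs V R v \<subseteq> nbrs (V - {x}) ?R v"
          proof
            fix u' assume "u' \<in> h ` nbrs V R v"
            then obtain u where u: "u' = h u" "u \<in> V" "(v, u) \<in> R" "u \<noteq> v" by (auto simp: nbrs_def)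
            have "(h v, h u) \<in> ?R" using u by force
            moreover have "h v = v" using v h by auto
            moreover have "h u \<noteq> v" "h u \<in> V - {x}" using u False h xy by (cases "u = x"; simp)+
            ultimately show "u' \<in> nbrs (V - {x}) ?R v" using u by (simp add: nbrs_def)
          qed
          have "3 \<le> card (h ` nbrs V R v)"
          proof (cases "x \<in> nbrs V R v \<and> y \<in> nbrs V R v")
            case True
            then have "card (nbrs V R v) \<noteq> 3" using none v False by blast
            then have "4 \<le> card (nbrs V R v)" using deg[of v] v by auto
            then have "3 \<le> card (nbrs V R v - {x})" using True finN by simp
            also have "\<dots> \<le> card (h ` nbrs V R v)"
              using h(3) finN by (intro card_mono) (auto intro!: rev_image_eqI)
            finally show ?thesis .
          next
            case False
            then have "inj_on h (nbrs V R v)" by (auto simp: inj_on_def h_def)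
            then show ?thesis using deg[of v] v by (simp add: card_image)
          qed
          also have "\<dots> \<le> card (nbrs (V - {x}) ?R v)" using sub fN by (rule card_mono[rotated])
          finally show ?thesis .
        next
          case True
          let ?A = "nbrs V R x - {y}" and ?B = "nbrs V R y - {x}"
          have xNy: "x \<in> nbrs V R y" using xy x by (simp add: nbrs_def)
          have sub: "?A \<union> ?B \<subseteq> nbrs (V - {x}) ?R v"
          proof
            fix u assume "u \<in> ?A \<union> ?B"
            then have u: "u \<in> V" "u \<noteq> x" "u \<noteq> y" "(x, u) \<in> R \<or> (y, u) \<in> R" by (auto simp: nbrs_def)
            then have "(y, u) \<in> ?R" using h(1,2) h(3)[of u] by force
            then show "u \<in> nbrs (V - {x}) ?R v" using u True by (simp add: nbrs_def)
          qed
          \<comment> \<open>The merged vertex can fail only if \<open>x\<close> and \<open>y\<close>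
            have the same two further neighbours, and that is excluded by
            \<open>twins\<close>.\<close>
          have "3 \<le> card (?A \<union> ?B)"
          proof (rule ccontr)
            assume "\<not> ?thesis"
            then have le: "card (?A \<union> ?B) \<le> 2" by simp
            have A: "2 \<le> card ?A" and B: "2 \<le> card ?B"
              using deg[of x] deg[of y] x y v True xNy finN by auto
            have AB: "?A = ?A \<union> ?B" "?B = ?A \<union> ?B"
              by (rule card_seteq; use A B le finN in auto)+
            then have eq: "?A = ?B" by simp
            have "card ?A = 2" using A le AB by (metis le_antisym)
            then obtain a b where ab: "?A = {a, b}" "a \<noteq> b" by (auto simp: card_2_iff)
            have "nbrs V R x = insert y ?A" "nbrs V R y = insert x ?B" using y xNy by auto
            then have "nbrs V R x = {y, a, b}" "nbrs V R y = {x, a, b}" using ab eq by simp_all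
            then show False using twins[of x y a b] x v True ab xy no by auto
          qed
          also have "\<dots> \<le> card (nbrs (V - {x}) ?R v)" using sub fN by (rule card_mono[rotated])
          finally show ?thesis .
        qed
      qed
      then obtain c where "k4_model (V - {x}) ?R c" by blast
      then have "k4_model V R (c \<circ> id(x := y))"
        unfolding h_def using x xy RV by (intro k4_model_contract) auto
      then show False using no by blast
    qed
    have "\<not> V \<subseteq> {s, t}" using cV card_mono[of "{s, t}" V] st by auto
    then obtain x where x: "x \<in> V - {s, t}" by blast
    then have "nbrs V R x \<noteq> {}" using deg[OF x] by auto
    then obtain y where y: "y \<in> nbrs V R x" by blast
    \<comment> \<open>\<open>common\<close> is applied twice: to \<open>x\<close> and
      \<open>y\<close>, giving \<open>z\<close> with neighbours \<open>x\<close>, \<open>y\<close>,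
      \<open>w\<close>; then to \<open>z\<close> and \<open>w\<close>, giving \<open>v\<close>,
      which must be \<open>x\<close> or \<open>y\<close>. With \<open>u\<close> the other of these
      two, \<open>z\<close> and \<open>v\<close> are adjacent and share the neighbours
      \<open>u\<close> and \<open>w\<close>, against \<open>twins\<close>.\<close>
    obtain z where z: "z \<in> V - {s, t}" "z \<noteq> x" "z \<noteq> y" "x \<in> nbrs V R z" "y \<in> nbrs V R z" "card (nbrs V R z) = 3"
      using common[OF x y] by blast
    have "x \<noteq> y" using y by (auto simp: nbrs_def)
    then obtain w where w: "nbrs V R z = {x, y, w}" "w \<noteq> x" "w \<noteq> y"
      using card3_obtain[OF z(6,4,5)] by blast
    have wz: "w \<noteq> z" "w \<in> nbrs V R z" using w by (auto simp: nbrs_def)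
    obtain v where v: "v \<in> V - {s, t}" "v \<noteq> z" "v \<noteq> w" "z \<in> nbrs V R v" "w \<in> nbrs V R v" "card (nbrs V R v) = 3"
      using common[OF z(1) wz(2)] by blast
    have "v \<in> nbrs V R z" using nbrs_sym[OF symR _ v(4)] v(1) by blast
    then have vxy: "v = x \<or> v = y" using w v(3) by auto
    have xNy: "x \<in> nbrs V R y" using nbrs_sym[OF symR _ y] x by blast
    define u where "u = (if v = x then y else x)"
    have u: "u \<in> nbrs V R v" "nbrs V R z = {v, u, w}" "u \<noteq> w" "u \<noteq> z"
      using vxy y xNy w z \<open>x \<noteq> y\<close> by (auto simp: u_def)
    have "nbrs V R v = {z, u, w}"
      using card3_obtain[OF v(6,4,5)] wz(1) u by (metis insert_iff singletonD insert_commute)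
    then show False using twins[OF z(1) v(1) _ u(2)] v(2) u(3) no by blast
  qed
qed

section \<open>Connected edge sets and exchange pairs under contraction, deletion and swaps\<close>

section \<open>Spanning trees under deletion and contraction\<close>

text \<open>Edge set and incidence map are separate arguments because deletion changes only the
  former, whereas contraction also relabels ends.\<close>

definition link :: "'e set \<Rightarrow> ('e \<Rightarrow> 'v set) \<Rightarrow> ('v \<times> 'v) set" where
  "link E n = {(u, v). \<exists>f\<in>E. n f = {u, v}}"

definition conn :: "'v set \<Rightarrow> 'e set \<Rightarrow> ('e \<Rightarrow> 'v set) \<Rightarrow> bool" where
  "conn V E n \<longleftrightarrow> (\<forall>u\<in>V. \<forall>v\<in>V. (u, v) \<in> (link E n)\<^sup>*)"

text \<open>Minimal connected edge sets replace spanning trees because minimality passes directly through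
  contractions and exchanges of edges.\<close>

definition mtree :: "'v set \<Rightarrow> ('e \<Rightarrow> 'v set) \<Rightarrow> 'e set \<Rightarrow> bool" where
  "mtree V n T \<longleftrightarrow> conn V T n \<and> (\<forall>f\<in>T. \<not> conn V (T - {f}) n)"

definition ends_ok :: "'v set \<Rightarrow> 'e set \<Rightarrow> ('e \<Rightarrow> 'v set) \<Rightarrow> bool" where
  "ends_ok V E n \<longleftrightarrow> (\<forall>f\<in>E. \<exists>p\<in>V. \<exists>q\<in>V. n f = {p, q})"

text \<open>The pattern behind \<open>Y_config\<close> with the edges themselves as coordinates; the
  ordering \<open>\<sigma>\<close> enters only when copies are turned into cube embeddings.\<close>

definition exchange_pairs :: "'v set \<Rightarrow> 'e set \<Rightarrow> ('e \<Rightarrow> 'v set) \<Rightarrow> 'e \<Rightarrow> ('e set \<times> 'e) set" where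
  "exchange_pairs V E n e = {(S, x). S \<subseteq> E - {e} \<and> x \<in> E - {e} \<and> x \<notin> S \<and>
     mtree V n (insert e S) \<and> mtree V n (insert x S)}"

lemma exchange_pairs_subset_pointed: "exchange_pairs V E n e \<subseteq> pointed (E - {e})"
  by (auto simp: exchange_pairs_def pointed_def)

lemma sym_link: "sym (link E n)"
  by (auto simp: link_def sym_def insert_commute)

lemma conn_cong: "(link E n)\<^sup>= = (link F n)\<^sup>= \<Longrightarrow> conn V E n = conn V F n"
  unfolding conn_def by (metis rtrancl_reflcl)

lemma conn_incident:
  assumes "conn V U n" "x \<in> V" "y \<in> V" "x \<noteq> y"
  shows "\<exists>g\<in>U. x \<in> n g"
proof -
  have "(x, y) \<in> (link U n)\<^sup>*" using assms by (auto simp: conn_def)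
  then obtain z where "(x, z) \<in> link U n" using assms(4) by (meson converse_rtranclE)
  then show ?thesis by (auto simp: link_def)
qed

text \<open>Walks project, with steps along \<open>f\<close> collapsing to a point. Conversely a
  step after contraction lifts to an edge of \<open>U\<close>, and gaps between \<open>x\<close> and
  \<open>w\<close> are closed by \<open>f\<close>.\<close>

lemma conn_contract:
  assumes U: "ends_ok V U n" and f: "n f = {x, w}" "x \<noteq> w" "x \<in> V" "w \<in> V"
  shows "conn V (insert f U) n \<longleftrightarrow> conn (V - {x}) U (\<lambda>g. id(x := w) ` n g)"
proof
  define h where "h = id(x := w)"
  have h: "h x = w" "h w = w" "\<And>v. v \<noteq> x \<Longrightarrow> h v = v" by (auto simp: h_def)
  {
    assume c: "conn V (insert f U) n"
    have "(h u, h v) \<in> (link U (\<lambda>g. h ` n g))\<^sup>*" if "(u, v) \<in> (link (insert f U) n)\<^sup>*" for u v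
      using that
    proof (induction rule: rtrancl_induct)
      case (step y z)
      from step(2) obtain g where g: "g \<in> insert f U" "n g = {y, z}" by (auto simp: link_def)
      show ?case
      proof (cases "g \<in> U")
        case True
        then have "(h y, h z) \<in> link U (\<lambda>g. h ` n g)" using g by (auto simp: link_def)
        then show ?thesis using step.IH by (meson rtrancl.rtrancl_into_rtrancl)
      next
        case False
        then have "{y, z} = {x, w}" using g f by auto
        then have "h y = h z" using h by (auto simp: doubleton_eq_iff)
        then show ?thesis using step.IH by simp
      qed
    qed simp
    moreover have "h u = u" if "u \<in> V - {x}" for u using that h by auto
    ultimately have "conn (V - {x}) U (\<lambda>g. h ` n g)"
      using c unfolding conn_def by (metis DiffD1)
    then show "conn (V - {x}) U (\<lambda>g. id(x := w) ` n g)" by (simp only: h_def)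
  }
  {
    assume "conn (V - {x}) U (\<lambda>g. id(x := w) ` n g)"
    then have c: "conn (V - {x}) U (\<lambda>g. h ` n g)" by (simp only: h_def)
    let ?L = "link (insert f U) n"
    have xw: "(x, w) \<in> ?L" "(w, x) \<in> ?L" using f by (auto simp: link_def insert_commute)
    have hv: "(h v, v) \<in> ?L\<^sup>*" "(v, h v) \<in> ?L\<^sup>*" for v
      using xw h by (cases "v = x"; auto)+
    have "(a, b) \<in> ?L\<^sup>*" if ab: "(a, b) \<in> link U (\<lambda>g. h ` n g)" for a b
    proof -
      obtain g where g: "g \<in> U" "h ` n g = {a, b}" using ab by (auto simp: link_def)
      obtain p q where pq: "n g = {p, q}" using U g unfolding ends_ok_def by blast
      then have "{h p, h q} = {a, b}" using g by simp
      then obtain p' q' where pq': "n g = {p', q'}" "a = h p'" "b = h q'"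
        using pq by (auto simp: doubleton_eq_iff)
      then have "(p', q') \<in> ?L" using g by (auto simp: link_def)
      then show ?thesis using hv pq' by (meson rtrancl.rtrancl_into_rtrancl rtrancl_trans)
    qed
    then have "link U (\<lambda>g. h ` n g) \<subseteq> ?L\<^sup>*" by auto
    then have "(link U (\<lambda>g. h ` n g))\<^sup>* \<subseteq> ?L\<^sup>*" by (metis rtrancl_subset_rtrancl)
    moreover have "(h u, h v) \<in> (link U (\<lambda>g. h ` n g))\<^sup>*" if "u \<in> V" "v \<in> V" for u v
      using c that h f unfolding conn_def by (metis DiffI singletonD)
    ultimately have "(h u, h v) \<in> ?L\<^sup>*" if "u \<in> V" "v \<in> V" for u v using that by blast
    then show "conn V (insert f U) n" unfolding conn_def using hv by (meson rtrancl_trans)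
  }
qed

lemma mtree_contract:
  assumes T: "mtree V n T" "g \<in> T" and U: "ends_ok V T n" and g: "n g = {x, w}" "x \<noteq> w" "x \<in> V" "w \<in> V"
  shows "mtree (V - {x}) (\<lambda>k. id(x := w) ` n k) (T - {g})"
proof -
  have eq: "conn (V - {x}) (W - {g}) (\<lambda>k. id(x := w) ` n k) = conn V W n" if "g \<in> W" "W \<subseteq> T" for W
  proof -
    have "ends_ok V (W - {g}) n" using U that by (auto simp: ends_ok_def)
    from conn_contract[OF this g] show ?thesis using that by (simp add: insert_absorb)
  qed
  show ?thesis
    unfolding mtree_def
  proof (intro conjI ballI)
    show "conn (V - {x}) (T - {g}) (\<lambda>k. id(x := w) ` n k)"
      using eq[OF T(2)] T(1) by (simp add: mtree_def)
    fix f assume f: "f \<in> T - {g}"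
    have "\<not> conn V (T - {f}) n" using f T(1) by (simp add: mtree_def)
    moreover have "T - {g} - {f} = T - {f} - {g}" by auto
    ultimately show "\<not> conn (V - {x}) (T - {g} - {f}) (\<lambda>k. id(x := w) ` n k)"
      using eq[of "T - {f}"] f T(2) by auto
  qed
qed

lemma link_image: "link (\<tau> ` U) n = link U (n \<circ> \<tau>)"
  by (auto simp: link_def)

lemma conn_swap_parallel:
  assumes "n f = n g"
  shows "conn V (Transposition.transpose f g ` U) n = conn V U n"
proof -
  have "n \<circ> Transposition.transpose f g = n"
    using assms by (auto simp: fun_eq_iff transpose_def)
  then show ?thesis by (simp add: conn_def link_image)
qed

text \<open>Here \<open>f\<close> is the only edge at \<open>x\<close>, so contracting it changes no
  other edge. The criterion does not mention \<open>w\<close>: it is irrelevant where a pendant edge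
  is attached.\<close>

lemma conn_insert_pendant:
  assumes U: "ends_ok V U n" "\<And>k. k \<in> U \<Longrightarrow> x \<notin> n k"
    and f: "n f = {x, w}" "x \<noteq> w" "x \<in> V" "w \<in> V"
  shows "conn V (insert f U) n = conn (V - {x}) U n"
proof -
  have "id(x := w) ` n k = n k" if "k \<in> U" for k
    using U(2)[OF that] by force
  then have "link U (\<lambda>k. id(x := w) ` n k) = link U n" by (auto simp: link_def)
  then show ?thesis unfolding conn_contract[OF U(1) f] by (simp add: conn_def)
qed

text \<open>Only \<open>f\<close> and \<open>g\<close> can meet \<open>x\<close>. If
  \<open>U\<close> contains both or neither, the swap fixes \<open>U\<close>; if exactly one, that
  edge is pendant at \<open>x\<close> and may be replaced by the other.\<close>

lemma conn_swap_series:
  assumes U: "ends_ok V U n" "\<And>k. k \<in> U \<Longrightarrow> k \<noteq> f \<Longrightarrow> k \<noteq> g \<Longrightarrow> x \<notin> n k"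
    and f: "n f = {x, u}" "x \<noteq> u" "x \<in> V" "u \<in> V"
    and g: "n g = {x, w}" "x \<noteq> w" "w \<in> V"
  shows "conn V (Transposition.transpose f g ` U) n = conn V U n"
proof -
  let ?t = "Transposition.transpose f g"
  define W where "W = U - {f, g}"
  have W: "ends_ok V W n" "\<And>k. k \<in> W \<Longrightarrow> x \<notin> n k"
    using U by (auto simp: W_def ends_ok_def)
  have eq: "conn V (insert f W) n = conn V (insert g W) n"
    using conn_insert_pendant[OF W f] conn_insert_pendant[OF W g(1,2) f(3) g(3)] by simp
  have tW: "?t ` W = W"
  proof -
    have "?t ` W = (\<lambda>k. k) ` W" by (rule image_cong) (auto simp: W_def transpose_def)
    then show ?thesis by simp
  qed
  consider "f \<in> U \<longleftrightarrow> g \<in> U" | "f \<in> U" "g \<notin> U" | "f \<notin> U" "g \<in> U" by blast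
  then show ?thesis
  proof cases
    case 1
    then have "?t ` U = U" by (rule transpose_image_eq)
    then show ?thesis by simp
  next
    case 2
    then have "U = insert f W" by (auto simp: W_def)
    then show ?thesis using tW eq by simp
  next
    case 3
    then have "U = insert g W" by (auto simp: W_def)
    then show ?thesis using tW eq by simp
  qed
qed

lemma exchange_pairs_swap:
  assumes sw: "\<And>U. U \<subseteq> E \<Longrightarrow> conn V (Transposition.transpose f g ` U) n = conn V U n"
    and fg: "f \<in> E - {e}" "g \<in> E - {e}" and e: "e \<in> E" and Sx: "(S, x) \<in> exchange_pairs V E n e"
  shows "(Transposition.transpose f g ` S, Transposition.transpose f g x) \<in> exchange_pairs V E n e"
proof -
  let ?t = "Transposition.transpose f g"
  \<comment> \<open>Minimality is a statement about connectedness of subsets of \<open>E\<close>, so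
    it is preserved along with connectedness.\<close>
  have tree: "mtree V n (?t ` T)" if T: "mtree V n T" "T \<subseteq> E" for T
    unfolding mtree_def
  proof (intro conjI ballI)
    show "conn V (?t ` T) n" using sw[OF T(2)] T(1) by (simp add: mtree_def)
    fix k assume "k \<in> ?t ` T"
    then obtain k' where k: "k' \<in> T" "k = ?t k'" by blast
    then have "?t ` T - {k} = ?t ` (T - {k'})" by (subst image_set_diff) auto
    moreover have "T - {k'} \<subseteq> E" using T by auto
    ultimately show "\<not> conn V (?t ` T - {k}) n" using sw k T(1) by (simp add: mtree_def)
  qed
  have te: "?t e = e" using fg by auto
  have D: "?t ` (E - {e}) = E - {e}" using fg by (intro transpose_image_eq) auto
  have "?t ` insert e S = insert e (?t ` S)" "?t ` insert x S = insert (?t x) (?t ` S)"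
    using te by auto
  then have "mtree V n (insert e (?t ` S))" "mtree V n (insert (?t x) (?t ` S))"
    using tree[of "insert e S"] tree[of "insert x S"] Sx e by (auto simp: exchange_pairs_def)
  moreover have "?t ` S \<subseteq> E - {e}" "?t x \<in> E - {e}" using Sx D by (auto simp: exchange_pairs_def)
  moreover have "?t x \<notin> ?t ` S" using Sx by (auto simp: exchange_pairs_def inj_image_mem_iff)
  ultimately show ?thesis by (simp add: exchange_pairs_def)
qed

lemma exchange_pairs_delete: "(S, x) \<in> exchange_pairs V E n e \<Longrightarrow> g \<notin> insert x S \<Longrightarrow> (S, x) \<in> exchange_pairs V (E - {g}) n e"
  by (auto simp: exchange_pairs_def)

text \<open>An edge of \<open>S\<close> belongs to both trees of the exchange, so it can be
  contracted in both at once.\<close>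

lemma exchange_pairs_contract:
  assumes Sx: "(S, y) \<in> exchange_pairs V E n e" and gS: "g \<in> S" and E: "ends_ok V E n" "e \<in> E"
    and g: "n g = {x, w}" "x \<noteq> w" "x \<in> V" "w \<in> V"
  shows "(S - {g}, y) \<in> exchange_pairs (V - {x}) (E - {g}) (\<lambda>k. id(x := w) ` n k) e"
proof -
  have S: "S \<subseteq> E - {e}" "y \<in> E - {e}" "y \<notin> S" "mtree V n (insert e S)" "mtree V n (insert y S)"
    using Sx by (auto simp: exchange_pairs_def)
  have "insert e S - {g} = insert e (S - {g})" "insert y S - {g} = insert y (S - {g})"
    using S gS by auto
  moreover have "ends_ok V (insert e S) n" "ends_ok V (insert y S) n"
    using E S by (auto simp: ends_ok_def)
  ultimately show ?thesis
    using mtree_contract[OF S(4) _ _ g] mtree_contract[OF S(5) _ _ g] S gS by (auto simp: exchange_pairs_def)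
qed

lemma mtree_no_loop:
  assumes "mtree V n T" "n g = {v}"
  shows "g \<notin> T"
proof
  assume "g \<in> T"
  have "(link T n)\<^sup>= = (link (T - {g}) n)\<^sup>="
    using assms(2) by (auto simp: link_def)
  from conn_cong[OF this] show False using assms(1) \<open>g \<in> T\<close> by (auto simp: mtree_def)
qed

lemma mtree_no_parallel:
  assumes "mtree V n T" "n f = n g" "f \<noteq> g" "f \<in> T"
  shows "g \<notin> T"
proof
  assume "g \<in> T"
  have "(\<exists>k\<in>T. n k = A) = (\<exists>k\<in>T - {g}. n k = A)" for A
    using assms(2-4) by (metis DiffD1 DiffI singletonD)
  then have "link T n = link (T - {g}) n" by (simp add: link_def)
  then show False using assms(1) \<open>g \<in> T\<close> by (auto simp: mtree_def conn_def)
qed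

lemma conn_nonempty: "conn V U n \<Longrightarrow> s \<in> V \<Longrightarrow> t \<in> V \<Longrightarrow> s \<noteq> t \<Longrightarrow> U \<noteq> {}"
  using conn_incident by fastforce

lemma link_subset: "ends_ok V E n \<Longrightarrow> link E n \<subseteq> V \<times> V"
  by (fastforce simp: link_def ends_ok_def doubleton_eq_iff)

text \<open>Lets \<open>k4_model_contract\<close> carry the absence of K4 models over to the
  contracted multigraph.\<close>

lemma link_contract_subset:
  assumes "ends_ok V E n"
  shows "link E (\<lambda>k. h ` n k) \<subseteq> map_prod h h ` link E n"
proof
  fix a assume "a \<in> link E (\<lambda>k. h ` n k)"
  then obtain g u v where g: "g \<in> E" "h ` n g = {u, v}" "a = (u, v)" by (auto simp: link_def)
  obtain p q where pq: "n g = {p, q}" using assms g unfolding ends_ok_def by blast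
  then have "{h p, h q} = {u, v}" using g by simp
  then obtain p' q' where pq': "n g = {p', q'}" "u = h p'" "v = h q'"
    using pq by (auto simp: doubleton_eq_iff)
  then have "(p', q') \<in> link E n" using g by (auto simp: link_def)
  then show "a \<in> map_prod h h ` link E n" using g pq' by force
qed

lemma ends_okE:
  assumes "ends_ok V E n" "f \<in> E"
  obtains p q where "p \<in> V" "q \<in> V" "n f = {p, q}"
  using assms unfolding ends_ok_def by blast

text \<open>Induction on the number of edges. Connectedness of \<open>E - {e}\<close> and
  \<open>s \<noteq> t\<close> say that \<open>e\<close> is neither a bridge nor a loop, and every
  reduction keeps both.\<close>

lemma power_saving_exchange_pairs:
  assumes "finite V" "finite E" "ends_ok V E n" "e \<in> E" "n e = {s, t}" "s \<noteq> t"
    and "conn V (E - {e}) n" and "\<nexists>c. k4_model V (link E n) c"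
  shows "power_saving (E - {e}) (exchange_pairs V E n e)"
  using assms
proof (induction "card E" arbitrary: V E n rule: less_induct)
  case less
  note finV = less.prems(1) and finE = less.prems(2) and ok = less.prems(3) and e = less.prems(4,5)
    and st = less.prems(6) and con = less.prems(7) and noK4 = less.prems(8)
  let ?D = "E - {e}"
  have stV: "s \<in> V" "t \<in> V" using ok e unfolding ends_ok_def by (metis insertCI insertE singletonD)+
  show ?case
  proof (cases "\<exists>g\<in>?D. (\<exists>v. n g = {v}) \<or> (\<exists>f\<in>?D. f \<noteq> g \<and> n f = n g)")
    case True
    then obtain g where g: "g \<in> ?D" and lp: "(\<exists>v. n g = {v}) \<or> (\<exists>f\<in>?D. f \<noteq> g \<and> n f = n g)" by blast
    have "(link ?D n)\<^sup>= = (link (?D - {g}) n)\<^sup>="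
      using lp
    proof
      assume "\<exists>v. n g = {v}"
      then show ?thesis by (auto simp: link_def)
    next
      assume "\<exists>f\<in>?D. f \<noteq> g \<and> n f = n g"
      then have "(\<exists>k\<in>?D. n k = A) = (\<exists>k\<in>?D - {g}. n k = A)" for A
        by (metis DiffD1 DiffI singletonD)
      then show ?thesis by (simp add: link_def)
    qed
    from conn_cong[OF this] have con': "conn V (?D - {g}) n" using con by simp
    have D': "E - {g} - {e} = ?D - {g}" by auto
    have IH: "power_saving (?D - {g}) (exchange_pairs V (E - {g}) n e)"
      unfolding D'[symmetric]
    proof (rule less.hyps)
      show "card (E - {g}) < card E" using g finE by (intro psubset_card_mono) auto
      show "ends_ok V (E - {g}) n" using ok by (auto simp: ends_ok_def)
      show "conn V (E - {g} - {e}) n" using con' D' by simp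
      show "\<nexists>c. k4_model V (link (E - {g}) n) c"
        using noK4 k4_model_mono[of V "link (E - {g}) n" _ V "link E n"] by (force simp: link_def)
    qed (use finV finE e st g in auto)
    \<comment> \<open>If \<open>g\<close> is a loop, no tree contains it and any other edge can
      serve as \<open>f\<close>; one exists because \<open>s\<close> and \<open>t\<close> remain
      connected without \<open>e\<close> and \<open>g\<close>.\<close>
    obtain f where f: "f \<in> ?D - {g}" "(\<exists>v. n g = {v}) \<or> n f = n g"
      using lp conn_nonempty[OF con' stV st] by blast
    have "power_saving (insert g (?D - {g})) (exchange_pairs V E n e)"
    proof (rule power_saving_parallel[OF IH])
      fix S x assume Sx: "(S, x) \<in> exchange_pairs V E n e"
      show "g \<notin> insert x S \<and> (S, x) \<in> exchange_pairs V (E - {g}) n e \<or>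
        f \<notin> insert x S \<and> (Transposition.transpose f g ` S, Transposition.transpose f g x) \<in> exchange_pairs V (E - {g}) n e"
      proof (cases "g \<in> insert x S")
        case False
        then show ?thesis using exchange_pairs_delete[OF Sx] by blast
      next
        case True
        have "mtree V n (insert x S)" using Sx by (simp add: exchange_pairs_def)
        then have fg: "n f = n g" "f \<notin> insert x S"
          using mtree_no_loop[of V n "insert x S" g] mtree_no_parallel[of V n "insert x S" f g] True f by auto
        have sw: "(Transposition.transpose f g ` S, Transposition.transpose f g x) \<in> exchange_pairs V E n e"
          by (rule exchange_pairs_swap[OF conn_swap_parallel _ _ _ Sx]) (use fg f g e in auto)
        have "g \<notin> Transposition.transpose f g ` insert x S"
          using fg(2) unfolding in_transpose_image_iff by simp
        then show ?thesis using exchange_pairs_delete[OF sw] fg by auto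
      qed
    qed (use finE f g exchange_pairs_subset_pointed[of V E n e] in \<open>auto simp: insert_absorb\<close>)
    then show ?thesis using g by (simp add: insert_absorb)
  next
    case False
    have noloop: "n g \<noteq> {v}" if "g \<in> ?D" for g v
      using False that by blast
    have nopar: "f = g" if "f \<in> ?D" "g \<in> ?D" "n f = n g" for f g
      using False that by blast
    show ?thesis
    proof (cases "V = {s, t}")
      case True
      \<comment> \<open>With only two vertices and no loops, every edge besides \<open>e\<close>
        joins \<open>s\<close> and \<open>t\<close>; \<open>nopar\<close> then leaves a single one,
        which is the base case.\<close>
      have st_edge: "n g = {s, t}" if gD: "g \<in> ?D" for g
      proof -
        obtain p q where pq: "p \<in> V" "q \<in> V" "n g = {p, q}" using ends_okE[OF ok, of g] gD by blast
        moreover have "p \<noteq> q" using noloop[OF gD, of p] pq by auto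
        ultimately show ?thesis unfolding True by auto
      qed
      obtain f where f: "f \<in> ?D" using conn_nonempty[OF con stV st] by blast
      have "g = f" if "g \<in> ?D" for g
        using that f by (rule nopar) (simp only: st_edge[OF that] st_edge[OF f])
      then have D: "?D = {f}" using f by blast
      have "exchange_pairs V E n e \<subseteq> {({}, f)}" unfolding exchange_pairs_def D by auto
      then show ?thesis unfolding D by (rule power_saving_singleton)
    next
      case False
      let ?R = "link E n"
      have RV: "?R \<subseteq> V \<times> V" using ok by (rule link_subset)
      have stR: "(s, t) \<in> ?R" using e by (auto simp: link_def)
      have "{s, t} \<subset> V" using False stV by auto
      then have "card {s, t} < card V" using finV by (rule psubset_card_mono[rotated])
      then have "3 \<le> card V" using st by simp
      then obtain x where x: "x \<in> V - {s, t}" and deg: "card (nbrs V ?R x) \<le> 2"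
        using k4_model_if_degree_ge_3[OF finV sym_link RV stR st] noK4 by force
      \<comment> \<open>Edges at \<open>x\<close> have distinct far ends, since outside
        \<open>e\<close> there are no loops and no parallel pairs. So the degree bound on neighbours
        bounds the number of edges at \<open>x\<close> by 2.\<close>
      define I where "I = {g \<in> E. x \<in> n g}"
      have eI: "e \<notin> I" using e x by (auto simp: I_def)
      have ends_I: "\<exists>w. w \<in> V \<and> w \<noteq> x \<and> n g = {x, w}" if "g \<in> I" for g
      proof -
        have gD: "g \<in> ?D" "x \<in> n g" using that eI by (auto simp: I_def)
        obtain p q where pq: "p \<in> V" "q \<in> V" "n g = {p, q}" using ends_okE[OF ok, of g] gD by blast
        moreover have "p \<noteq> q" using noloop[OF gD(1), of p] pq by auto
        ultimately show ?thesis using gD(2) by auto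
      qed
      then obtain far where far: "\<And>g. g \<in> I \<Longrightarrow> far g \<in> V \<and> far g \<noteq> x \<and> n g = {x, far g}" by metis
      have "inj_on far I"
      proof (rule inj_onI)
        fix f g assume fg: "f \<in> I" "g \<in> I" "far f = far g"
        then have "n f = n g" using far by metis
        then show "f = g" using fg eI by (intro nopar) (auto simp: I_def)
      qed
      moreover have "far ` I \<subseteq> nbrs V ?R x"
        using far by (fastforce simp: nbrs_def link_def I_def)
      ultimately have "card I \<le> card (nbrs V ?R x)"
        using finV by (intro card_inj_on_le[of far]) (auto simp: finite_nbrs)
      then have cI: "card I \<le> 2" using deg by simp
      have finI: "finite I" using finE by (simp add: I_def)
      have xs: "x \<in> V" "x \<noteq> s" using x by auto
      obtain g where g: "g \<in> I" using conn_incident[OF con xs(1) stV(1) xs(2)] by (auto simp: I_def)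
      define w where "w = far g"
      have gw: "n g = {x, w}" "x \<noteq> w" "w \<in> V" using far[OF g] by (auto simp: w_def)
      have gD: "g \<in> ?D" using g eI by (auto simp: I_def)
      \<comment> \<open>Contract \<open>g\<close> by moving \<open>x\<close> to \<open>w\<close>. As
        \<open>x\<close> is neither \<open>s\<close> nor \<open>t\<close>, the ends of
        \<open>e\<close> stay fixed.\<close>
      let ?V = "V - {x}" and ?n = "\<lambda>k. id(x := w) ` n k"
      have D': "E - {g} - {e} = ?D - {g}" by auto
      have ne: "?n e = {s, t}" using e x by auto
      have con': "conn ?V (?D - {g}) ?n"
      proof -
        have "ends_ok V (?D - {g}) n" using ok by (auto simp: ends_ok_def)
        from conn_contract[OF this gw(1,2) xs(1) gw(3)] show ?thesis using con gD by (simp add: insert_absorb)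
      qed
      have "(x, w) \<in> ?R" "(w, x) \<in> ?R" using gw g by (auto simp: link_def I_def insert_commute)
      note contract = k4_model_contract[OF _ xs(1) gw(3,2) RV this]
      have IH: "power_saving (?D - {g}) (exchange_pairs ?V (E - {g}) ?n e)"
        unfolding D'[symmetric]
      proof (rule less.hyps)
        show "card (E - {g}) < card E" using gD finE by (intro psubset_card_mono) auto
        show "ends_ok ?V (E - {g}) ?n"
          unfolding ends_ok_def
        proof
          fix k assume "k \<in> E - {g}"
          then obtain p q where "p \<in> V" "q \<in> V" "n k = {p, q}" using ends_okE[OF ok, of k] by blast
          then show "\<exists>p\<in>?V. \<exists>q\<in>?V. ?n k = {p, q}"
            using gw by (intro bexI[of _ "(id(x := w)) p"] bexI[of _ "(id(x := w)) q"]) auto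
        qed
        show "conn ?V (E - {g} - {e}) ?n" using con' D' by simp
        show "\<nexists>c. k4_model ?V (link (E - {g}) ?n) c"
        proof
          assume "\<exists>c. k4_model ?V (link (E - {g}) ?n) c"
          moreover have "link (E - {g}) ?n \<subseteq> link E ?n" by (auto simp: link_def)
          then have "link (E - {g}) ?n \<subseteq> map_prod (id(x := w)) (id(x := w)) ` ?R"
            using link_contract_subset[OF ok] by (rule subset_trans)
          ultimately obtain c where "k4_model ?V (map_prod (id(x := w)) (id(x := w)) ` ?R) c"
            using k4_model_mono by blast
          from contract[OF this] show False using noK4 by blast
        qed
      qed (use finV finE e ne st gD in auto)
      \<comment> \<open>\<open>f\<close> is the second edge at \<open>x\<close> if there is one.
        Otherwise \<open>g\<close> lies in every \<open>S\<close>, and an arbitrary other edge can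
        serve as \<open>f\<close>.\<close>
      obtain f where f: "f \<in> ?D - {g}" "I = {g} \<or> I = {g, f}"
      proof (cases "I = {g}")
        case True
        have "s \<in> ?V" "t \<in> ?V" using stV x by auto
        then show ?thesis using conn_nonempty[OF con' _ _ st] that True by blast
      next
        case False
        then obtain f where f: "f \<in> I" "f \<noteq> g" using g by blast
        then have "{g, f} = I" using g finI cI by (intro card_seteq) auto
        moreover have "f \<in> ?D - {g}" using f eI by (auto simp: I_def)
        ultimately show ?thesis using that by blast
      qed
      have "power_saving (insert g (?D - {g})) (exchange_pairs V E n e)"
      proof (rule power_saving_series[OF IH])
        show "exchange_pairs ?V (E - {g}) ?n e \<subseteq> pointed (?D - {g})"
          using exchange_pairs_subset_pointed[of ?V "E - {g}" ?n e] D' by simp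
        fix S y assume Sy: "(S, y) \<in> exchange_pairs V E n e"
        let ?t = "Transposition.transpose f g"
        \<comment> \<open>The tree \<open>insert e S\<close> has an edge at \<open>x\<close>, and
          this is not \<open>e\<close>; so \<open>S\<close> contains \<open>g\<close> or the second
          edge at \<open>x\<close>, as the series step requires.\<close>
        have con_S: "conn V (insert e S) n" and SE: "S \<subseteq> ?D"
          using Sy by (auto simp: exchange_pairs_def mtree_def)
        obtain k where k: "k \<in> insert e S" "x \<in> n k"
          using conn_incident[OF con_S xs(1) stV(1) xs(2)] by blast
        then have "k \<in> I" using SE e by (auto simp: I_def)
        then have kS: "k \<in> S" "k \<in> I" using k eI by auto
        show "g \<in> S \<and> (S - {g}, y) \<in> exchange_pairs ?V (E - {g}) ?n e \<or>
          f \<in> S \<and> (?t ` S - {g}, ?t y) \<in> exchange_pairs ?V (E - {g}) ?n e"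
        proof (cases "g \<in> S")
          case True
          then show ?thesis using exchange_pairs_contract[OF Sy True ok e(1) gw(1,2) xs(1) gw(3)] by blast
        next
          case False
          then have "k \<noteq> g" using kS by auto
          then have fI: "I = {g, f}" "f \<in> S" using f(2) kS by auto
          have fu: "n f = {x, far f}" "x \<noteq> far f" "far f \<in> V" using far[of f] fI by auto
          have sw: "(?t ` S, ?t y) \<in> exchange_pairs V E n e"
          proof (rule exchange_pairs_swap[OF _ _ _ e(1) Sy])
            fix U assume U: "U \<subseteq> E"
            have "ends_ok V U n" using U ok by (auto simp: ends_ok_def)
            moreover have "x \<notin> n k" if "k \<in> U" "k \<noteq> f" "k \<noteq> g" for k
              using that U fI(1) by (auto simp: I_def)
            ultimately show "conn V (?t ` U) n = conn V U n"
              using fu gw xs(1) by (intro conn_swap_series)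
          qed (use f gD in auto)
          have "g \<in> ?t ` S" using fI(2) by (metis image_eqI transpose_apply_first)
          then show ?thesis
            using exchange_pairs_contract[OF sw _ ok e(1) gw(1,2) xs(1) gw(3)] fI(2) by blast
        qed
      qed (use finE f gD exchange_pairs_subset_pointed[of V E n e] in \<open>auto simp: insert_absorb\<close>)
      then show ?thesis using gD by (simp add: insert_absorb)
    qed
  qed
qed

section \<open>Translation to minors, spanning trees and cube embeddings as defined at the
  outset\<close>

section \<open>Minors, cycles and cube embeddings\<close>

lemma adj_eq_link: "adj G = link (edges G) (ends G)"
  by (simp add: adj_def link_def)

text \<open>The classes of \<open>c\<close> are the branch sets, all edges inside a class below 4
  are contracted, and \<open>\<phi>\<close> picks an edge between each two classes. Such an edge
  avoids \<open>C\<close> because its ends have different values.\<close>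

lemma k4_model_is_minor:
  assumes G: "fin_multigraph G" and c: "k4_model (verts G) (link (edges G) (ends G)) c"
  shows "is_minor (complete_graph 4) G"
proof -
  interpret fin_multigraph G by (rule G)
  define B where "B i = {v \<in> verts G. c v = i}" for i
  define C where "C = {f \<in> edges G. \<exists>i<4. ends G f \<subseteq> B i}"
  define \<phi> where "\<phi> A = (SOME g. g \<in> edges G \<and> c ` ends G g = A)" for A
  have \<phi>: "\<phi> A \<in> edges G \<and> c ` ends G (\<phi> A) = A" if A: "A \<subseteq> {..<4}" "card A = 2" for A
  proof -
    obtain i j where ij: "A = {i, j}" "i \<noteq> j" using A(2) by (auto simp: card_2_iff)
    then obtain u v where uv: "c u = i" "c v = j" "(u, v) \<in> link (edges G) (ends G)"
      using c A(1) unfolding k4_model_def by (metis insert_subset lessThan_iff)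
    then have "\<exists>g. g \<in> edges G \<and> c ` ends G g = A" using ij by (auto simp: link_def)
    then show ?thesis unfolding \<phi>_def by (rule someI_ex)
  qed
  have \<phi>B: "v \<in> B (c v)" if "A \<subseteq> {..<4}" "card A = 2" "v \<in> ends G (\<phi> A)" for A v
    using \<phi>[OF that(1,2)] ends_in_verts that(3) by (auto simp: B_def)
  have \<phi>C: "\<phi> A \<notin> C" if A: "A \<subseteq> {..<4}" "card A = 2" for A
  proof
    assume "\<phi> A \<in> C"
    then obtain i where "ends G (\<phi> A) \<subseteq> B i" by (auto simp: C_def)
    then have "A \<subseteq> {i}" using \<phi>[OF A] by (auto simp: B_def)
    then have "card A \<le> card {i}" by (intro card_mono) auto
    then show False using A by simp
  qed
  have conB: "mconnected (subgraph_on G (B i) C)" if "i < 4" for i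
  proof -
    have "Restr (link (edges G) (ends G)) (B i) \<subseteq> adj (subgraph_on G (B i) C)"
      using that by (force simp: link_def adj_def subgraph_on_def C_def)
    then have "(Restr (link (edges G) (ends G)) (B i))\<^sup>* \<subseteq> (adj (subgraph_on G (B i) C))\<^sup>*"
      by (rule rtrancl_mono)
    moreover have "B i \<noteq> {}" using c that unfolding k4_model_def B_def by blast
    moreover have "(u, v) \<in> (Restr (link (edges G) (ends G)) (B i))\<^sup>*" if uv: "u \<in> B i" "v \<in> B i" for u v
    proof -
      have "u \<in> verts G" "v \<in> verts G" "c u = c v" "c v < 4" using uv \<open>i < 4\<close> by (auto simp: B_def)
      then have "(u, v) \<in> (Restr (link (edges G) (ends G)) {w \<in> verts G. c w = c v})\<^sup>*"
        using c unfolding k4_model_def by blast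
      moreover have "c v = i" using uv by (simp add: B_def)
      ultimately show ?thesis by (simp only: B_def)
    qed
    ultimately show ?thesis by (auto simp: mconnected_def subgraph_on_def)
  qed
  show ?thesis
    unfolding is_minor_def
  proof (intro exI[of _ B] exI[of _ C] exI[of _ \<phi>] conjI ballI)
    show "C \<subseteq> edges G" by (auto simp: C_def)
    show "B i \<subseteq> verts G" for i by (auto simp: B_def)
    show "mconnected (subgraph_on G (B i) C)" if "i \<in> verts (complete_graph 4)" for i
      using conB that by (simp add: complete_graph_def)
    show "disjoint_family_on B (verts (complete_graph 4))"
      by (auto simp: disjoint_family_on_def B_def)
    show "inj_on \<phi> (edges (complete_graph 4))"
    proof (rule inj_onI)
      fix A A' assume "A \<in> edges (complete_graph 4)" "A' \<in> edges (complete_graph 4)" and eq: "\<phi> A = \<phi> A'"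
      then have A: "A \<subseteq> {..<4}" "card A = 2" "A' \<subseteq> {..<4}" "card A' = 2"
        by (simp_all add: complete_graph_def)
      show "A = A'" using \<phi>[OF A(1,2)] \<phi>[OF A(3,4)] eq by metis
    qed
    show "\<phi> ` edges (complete_graph 4) \<subseteq> edges G - C"
      using \<phi> \<phi>C by (auto simp: complete_graph_def)
    fix A assume "A \<in> edges (complete_graph 4)"
    then have A: "A \<subseteq> {..<4}" "card A = 2" "ends (complete_graph 4) A = A"
      by (auto simp: complete_graph_def)
    have im: "c ` ends G (\<phi> A) = A" using \<phi>[OF A(1,2)] by simp
    show "ends G (\<phi> A) \<subseteq> (\<Union>x\<in>ends (complete_graph 4) A. B x)"
      using \<phi>B[OF A(1,2)] im unfolding A(3) by blast
    fix x assume "x \<in> ends (complete_graph 4) A"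
    then have "x \<in> c ` ends G (\<phi> A)" unfolding im A(3) .
    then obtain v where "v \<in> ends G (\<phi> A)" "c v = x" by blast
    then show "ends G (\<phi> A) \<inter> B x \<noteq> {}" using \<phi>B[OF A(1,2)] by blast
  qed
qed

text \<open>A walk that returns to a visited vertex is cut back to the first visit. The two lists
  have the shape that \<open>is_cycle\<close> expects once a closing edge is appended.\<close>

lemma simple_path:
  assumes "(a, b) \<in> (link U n)\<^sup>*"
  shows "\<exists>vs es. length vs = Suc (length es) \<and> distinct vs \<and> vs ! 0 = a \<and> vs ! length es = b \<and>
    set es \<subseteq> U \<and> (\<forall>i<length es. n (es ! i) = {vs ! i, vs ! Suc i})"
  using assms
proof (induction rule: rtrancl_induct)
  case base
  show ?case by (intro exI[of _ "[a]"] exI[of _ "[]"]) auto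
next
  case (step y z)
  then obtain vs es where p: "length vs = Suc (length es)" "distinct vs" "vs ! 0 = a" "vs ! length es = y"
    "set es \<subseteq> U" "\<forall>i<length es. n (es ! i) = {vs ! i, vs ! Suc i}" by blast
  show ?case
  proof (cases "z \<in> set vs")
    case True
    then obtain k where k: "k < length vs" "vs ! k = z" by (auto simp: in_set_conv_nth)
    have "k \<le> length es" using k p(1) by simp
    then show ?thesis
      using p k set_take_subset[of k es]
      by (intro exI[of _ "take (Suc k) vs"] exI[of _ "take k es"]) (auto simp: min_absorb2)
  next
    case False
    obtain g where g: "g \<in> U" "n g = {y, z}" using step(2) by (auto simp: link_def)
    show ?thesis
      using p g False
      by (intro exI[of _ "vs @ [z]"] exI[of _ "es @ [g]"]) (auto simp: nth_append less_Suc_eq)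
  qed
qed

text \<open>If \<open>T - {f}\<close> were still connected, a simple path in it between the ends of
  \<open>f\<close> would close up with \<open>f\<close> to a cycle; a loop is a cycle by
  itself.\<close>

lemma mtree_if_spanning_tree:
  assumes G: "fin_multigraph G" and T: "spanning_tree G T"
  shows "mtree (verts G) (ends G) T"
proof -
  interpret fin_multigraph G by (rule G)
  let ?n = "ends G"
  have TE: "T \<subseteq> edges G" and con: "mconnected (G\<lparr>edges := T\<rparr>)"
    and nocyc: "\<And>vs es. \<not> is_cycle (G\<lparr>edges := T\<rparr>) vs es"
    using T by (auto simp: spanning_tree_def is_tree_def)
  have "\<not> conn (verts G) (T - {f}) ?n" if f: "f \<in> T" for f
  proof
    assume con': "conn (verts G) (T - {f}) ?n"
    have fE: "f \<in> edges G" using f TE by auto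
    consider v where "?n f = {v}" | a b where "?n f = {a, b}" "a \<noteq> b"
      using card_ends[OF fE] by (auto simp: card_1_singleton_iff card_2_iff)
    then show False
    proof cases
      case (1 v)
      then have "is_cycle (G\<lparr>edges := T\<rparr>) [v] [f]"
        using ends_in_verts[OF fE] f by (simp add: is_cycle_def)
      then show False using nocyc by blast
    next
      case (2 a b)
      then have "a \<in> verts G" "b \<in> verts G" using ends_in_verts[OF fE] by auto
      then have "(a, b) \<in> (link (T - {f}) ?n)\<^sup>*" using con' by (simp add: conn_def)
      then obtain vs es where p: "length vs = Suc (length es)" "distinct vs" "vs ! 0 = a" "vs ! length es = b"
        "set es \<subseteq> T - {f}" "\<forall>i<length es. ?n (es ! i) = {vs ! i, vs ! Suc i}"
        using simple_path by (metis (no_types, lifting))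
      \<comment> \<open>On a path with distinct vertices the two ends of an edge determine its
        position.\<close>
      have "distinct es"
        unfolding distinct_conv_nth
      proof (intro allI impI notI)
        fix i j assume ij: "i < length es" "j < length es" "i \<noteq> j" "es ! i = es ! j"
        then have "{vs ! i, vs ! Suc i} = {vs ! j, vs ! Suc j}" using p(6) by metis
        moreover have "vs ! k = vs ! l \<longleftrightarrow> k = l" if "k \<le> length es" "l \<le> length es" for k l
          using that p(1,2) by (simp add: nth_eq_iff_index_eq)
        ultimately show False using ij(1-3) by (auto simp: doubleton_eq_iff)
      qed
      moreover have "set vs \<subseteq> verts G"
      proof
        fix v assume "v \<in> set vs"
        then obtain k where k: "k < length vs" "v = vs ! k" by (auto simp: in_set_conv_nth)
        show "v \<in> verts G"
        proof (cases "k < length es")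
          case True
          then have "v \<in> ?n (es ! k)" using p(6) k by auto
          moreover have "es ! k \<in> edges G" using True p(5) TE by (meson DiffD1 nth_mem subsetD)
          ultimately show ?thesis using ends_in_verts by blast
        next
          case False
          then have "k = length es" using k p(1) by simp
          then show ?thesis using k p(4) \<open>b \<in> verts G\<close> by simp
        qed
      qed
      \<comment> \<open>The last index \<open>length es\<close> belongs to \<open>f\<close>; there
        the successor wraps around to 0, the other end \<open>a\<close> of \<open>f\<close>.\<close>
      moreover have "?n ((es @ [f]) ! i) = {vs ! i, vs ! (Suc i mod length vs)}" if "i < length vs" for i
      proof (cases "i < length es")
        case True
        then show ?thesis using p(1,6) by (simp add: nth_append)
      next
        case False
        then have "i = length es" using that p(1) by simp
        then show ?thesis using p(1,3,4) 2 by (simp add: insert_commute)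
      qed
      ultimately have "is_cycle (G\<lparr>edges := T\<rparr>) vs (es @ [f])"
        using p(1,2,5) f by (auto simp: is_cycle_def)
      then show False using nocyc by blast
    qed
  qed
  moreover have "conn (verts G) T ?n"
    using con by (simp add: mconnected_def conn_def adj_eq_link)
  ultimately show ?thesis by (simp add: mtree_def)
qed

section \<open>From copies to cube embeddings\<close>

lemma cube_edge_iff:
  "{X, X'} \<in> cube_edges n \<longleftrightarrow>
    (\<exists>i<n. i \<notin> X \<and> X \<subseteq> {..<n} \<and> X' = insert i X) \<or> (\<exists>i<n. i \<notin> X' \<and> X' \<subseteq> {..<n} \<and> X = insert i X')"
  by (auto simp: cube_edges_def cube_verts_def doubleton_eq_iff)

text \<open>Intersecting the image of \<open>X\<close> with the free coordinates recovers the image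
  of \<open>X\<close> under \<open>\<tau>\<close>, and hence \<open>X\<close>. This gives
  injectivity and pulls edges of the face back.\<close>

lemma cube_embedding_image:
  assumes \<tau>: "inj_on \<tau> {..<d}" "\<tau> ` {..<d} \<subseteq> {..<n}" and A: "A \<subseteq> {..<n}" "A \<inter> \<tau> ` {..<d} = {}"
  shows "cube_embedding d n (\<lambda>X. A \<union> \<tau> ` X)"
  unfolding cube_embedding_def
proof (intro conjI exI ballI)
  let ?D = "\<tau> ` {..<d}" and ?\<psi> = "\<lambda>X. A \<union> \<tau> ` X"
  show "is_face d n (face n ?D A)"
    unfolding is_face_def
    by (intro exI[of _ ?D] exI[of _ A]) (use \<tau> A in \<open>auto simp: cube_verts_def card_image\<close>)
  have trace: "?\<psi> X \<inter> ?D = \<tau> ` X" if "X \<subseteq> {..<d}" for X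
    using that A(2) by auto
  have inj: "X = X'" if "\<tau> ` X = \<tau> ` X'" "X \<subseteq> {..<d}" "X' \<subseteq> {..<d}" for X X'
    using inj_on_image_eq_iff[OF \<tau>(1) that(2,3)] that(1) by simp
  show "bij_betw ?\<psi> (cube_verts d) (face n ?D A)"
    unfolding bij_betw_def
  proof
    show "inj_on ?\<psi> (cube_verts d)"
      by (rule inj_onI) (metis trace inj cube_verts_def PowD)
    show "?\<psi> ` cube_verts d = face n ?D A"
    proof
      show "?\<psi> ` cube_verts d \<subseteq> face n ?D A"
        using \<tau> A by (auto simp: cube_verts_def face_def image_subset_iff)
      show "face n ?D A \<subseteq> ?\<psi> ` cube_verts d"
      proof
        fix X assume "X \<in> face n ?D A"
        then have X: "X \<subseteq> {..<n}" "X - ?D = A" using A(2) by (auto simp: face_def cube_verts_def)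
        have "X = ?\<psi> {i \<in> {..<d}. \<tau> i \<in> X}" using X(2) by auto
        then show "X \<in> ?\<psi> ` cube_verts d" by (rule image_eqI) (auto simp: cube_verts_def)
      qed
    qed
  qed
  \<comment> \<open>Adjacency is a disjunction of two directed statements, exchanged by swapping
    \<open>X\<close> and \<open>X'\<close>; one direction suffices.\<close>
  have half: "(\<exists>i<d. i \<notin> X \<and> X \<subseteq> {..<d} \<and> X' = insert i X) \<longleftrightarrow>
      (\<exists>i<n. i \<notin> ?\<psi> X \<and> ?\<psi> X \<subseteq> {..<n} \<and> ?\<psi> X' = insert i (?\<psi> X))" (is "?l \<longleftrightarrow> ?r")
    if X: "X \<subseteq> {..<d}" "X' \<subseteq> {..<d}" for X X'
  proof
    assume ?l
    then obtain i where i: "i < d" "i \<notin> X" "X' = insert i X" by blast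
    have "\<tau> i \<notin> \<tau> ` X" using i X \<tau>(1) by (auto simp: inj_on_def)
    moreover have "\<tau> i \<in> ?D" using i by auto
    ultimately have "\<tau> i < n" "\<tau> i \<notin> ?\<psi> X" using \<tau>(2) A(2) by auto
    moreover have "?\<psi> X \<subseteq> {..<n}" using A(1) \<tau>(2) X by auto
    ultimately show ?r using i by auto
  next
    assume ?r
    then obtain i where i: "i \<notin> ?\<psi> X" "?\<psi> X' = insert i (?\<psi> X)" by blast
    then have "i \<in> \<tau> ` X'" by auto
    then obtain j where j: "j \<in> X'" "i = \<tau> j" by blast
    have "\<tau> ` X' = ?\<psi> X' \<inter> ?D" using trace X by simp
    also have "\<dots> = insert i (?\<psi> X \<inter> ?D)" using i j X by auto
    also have "\<dots> = \<tau> ` insert j X" using trace X j by simp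
    finally have "X' = insert j X" by (rule inj) (use X j in auto)
    then show ?l using i j X by auto
  qed
  fix X X' assume "X \<in> cube_verts d" "X' \<in> cube_verts d"
  then have X: "X \<subseteq> {..<d}" "X' \<subseteq> {..<d}" by (auto simp: cube_verts_def)
  show "{X, X'} \<in> cube_edges d \<longleftrightarrow> {?\<psi> X, ?\<psi> X'} \<in> cube_edges n"
    unfolding cube_edge_iff half[OF X] half[OF X(2,1)] ..
qed

text \<open>A copy \<open>(A, \<phi>)\<close> yields the embedding that sends \<open>X\<close> to
  the union of \<open>A\<close> with the image of \<open>X\<close> under
  \<open>\<phi> \<circ> \<sigma>\<close>, and this would map the whole configuration into
  \<open>W\<close>.\<close>

lemma copies_empty_if_avoiding:
  assumes G: "fin_multigraph G" and \<sigma>: "bij_betw \<sigma> {..<card (edges G) - 1} (edges G - {e})"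
    and av: "\<forall>\<psi>. cube_embedding (card (edges G) - 1) n \<psi> \<longrightarrow> \<not> (\<lambda>f. \<psi> ` f) ` Y_config G e \<sigma> \<subseteq> W"
  shows "copies n (edges G - {e}) (exchange_pairs (verts G) (edges G) (ends G) e)
    {(B, y) \<in> pointed {..<n}. {B, insert y B} \<in> W} = {}" (is "copies n ?D ?P ?Es = {}")
proof (rule ccontr)
  let ?d = "card (edges G) - 1"
  assume "copies n ?D ?P ?Es \<noteq> {}"
  then obtain A \<phi> where "(A, \<phi>) \<in> copies n ?D ?P ?Es" by auto
  then have \<phi>: "A \<subseteq> {..<n}" "\<phi> \<in> ?D \<rightarrow>\<^sub>E {..<n}" "inj_on \<phi> ?D" "A \<inter> \<phi> ` ?D = {}"
    and cp: "\<And>S x. (S, x) \<in> ?P \<Longrightarrow> (A \<union> \<phi> ` S, \<phi> x) \<in> ?Es"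
    by (auto simp: copies_def)
  let ?\<psi> = "\<lambda>X. A \<union> (\<phi> \<circ> \<sigma>) ` X"
  have im: "(\<phi> \<circ> \<sigma>) ` {..<?d} = \<phi> ` ?D" using \<sigma> by (simp only: bij_betw_def image_comp[symmetric])
  have "cube_embedding ?d n ?\<psi>"
  proof (rule cube_embedding_image)
    show "inj_on (\<phi> \<circ> \<sigma>) {..<?d}" using \<sigma> \<phi>(3) by (auto simp: bij_betw_def intro: comp_inj_on)
  qed (use \<phi> im in auto)
  moreover have "(\<lambda>f. ?\<psi> ` f) ` Y_config G e \<sigma> \<subseteq> W"
  proof
    fix F assume "F \<in> (\<lambda>f. ?\<psi> ` f) ` Y_config G e \<sigma>"
    then obtain S i where F: "F = ?\<psi> ` {S, insert i S}" and S: "S \<subseteq> {..<?d}" "i < ?d" "i \<notin> S"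
      and T: "spanning_tree G (insert e (\<sigma> ` S))" "spanning_tree G (insert (\<sigma> i) (\<sigma> ` S))"
      by (auto simp: Y_config_def cube_verts_def)
    have "\<sigma> ` S \<subseteq> ?D" "\<sigma> i \<in> ?D" using \<sigma> S by (auto simp: bij_betw_def)
    moreover have "\<sigma> i \<notin> \<sigma> ` S"
      using \<sigma> S by (auto simp: bij_betw_def inj_on_def)
    ultimately have "(\<sigma> ` S, \<sigma> i) \<in> ?P"
      using T by (auto simp: exchange_pairs_def intro: mtree_if_spanning_tree[OF G])
    from cp[OF this] show "F \<in> W" by (simp add: F image_comp)
  qed
  ultimately show False using av by blast
qed

text \<open>Every cube edge is recovered from its lower end and direction, so passing to pairs loses
  no edges.\<close>

lemma card_le_card_pairs:
  assumes "W \<subseteq> cube_edges n"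
  shows "card W \<le> card {(B, y) \<in> pointed {..<n}. {B, insert y B} \<in> W}" (is "_ \<le> card ?Es")
proof (rule surj_card_le)
  show "finite ?Es" by (rule finite_subset[of _ "pointed {..<n}"]) (auto simp: finite_pointed)
  show "W \<subseteq> (\<lambda>(B, y). {B, insert y B}) ` ?Es"
  proof
    fix F assume F: "F \<in> W"
    then obtain B y where By: "F = {B, insert y B}" "B \<subseteq> {..<n}" "y < n" "y \<notin> B"
      using assms by (auto simp: cube_edges_def cube_verts_def)
    then have "(B, y) \<in> ?Es" using F by (simp add: pointed_def)
    then show "F \<in> (\<lambda>(B, y). {B, insert y B}) ` ?Es" unfolding By(1) by (rule rev_image_eqI) simp
  qed
qed

section \<open>From supersaturation to the bound on the extremal number\<close>

theorem theorem1p2: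
  fixes G :: "('v, 'e) mgraph" and e :: 'e and \<sigma> :: "nat \<Rightarrow> 'e"
  assumes "series_parallel G"
    and "mconnected G"
    and "e \<in> edges G"
    and "\<not> is_bridge G e"
    and "\<not> is_loop G e"
    and "bij_betw \<sigma> {..<card (edges G) - 1} (edges G - {e})"
  shows "\<exists>\<epsilon>>0. (\<lambda>n. real (cube_ex (card (edges G) - 1) n (Y_config G e \<sigma>)))
           \<in> O(\<lambda>n. real n powr (-\<epsilon>) * real (card (cube_edges n)))"
proof -
  have G: "fin_multigraph G" and noK4: "\<not> is_minor (complete_graph 4) G"
    using assms(1) by (auto simp: series_parallel_def)
  interpret fin_multigraph G by (rule G)
  let ?D = "edges G - {e}" and ?P = "exchange_pairs (verts G) (edges G) (ends G) e"
  let ?d = "card (edges G) - 1" and ?Y = "Y_config G e \<sigma>"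
  obtain s t where st: "ends G e = {s, t}" "s \<noteq> t"
    using card_ends[OF assms(3)] assms(3,5) by (auto simp: is_loop_def card_1_singleton_iff card_2_iff)
  have "power_saving ?D ?P"
  proof (rule power_saving_exchange_pairs[where s = s and t = t])
    show "ends_ok (verts G) (edges G) (ends G)"
      unfolding ends_ok_def
    proof
      fix f assume f: "f \<in> edges G"
      then obtain p q where "ends G f = {p, q}"
        using card_ends[OF f] by (auto simp: card_1_singleton_iff card_2_iff)
      then show "\<exists>p\<in>verts G. \<exists>q\<in>verts G. ends G f = {p, q}" using ends_in_verts[OF f] by auto
    qed
    show "conn (verts G) ?D (ends G)"
      using assms(2-4) by (auto simp: conn_def mconnected_def is_bridge_def adj_eq_link delete_edge_def)
    show "\<nexists>c. k4_model (verts G) (link (edges G) (ends G)) c"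
      using noK4 k4_model_is_minor[OF G] by blast
  qed (use finite_verts finite_edges assms(3) st in auto)
  then obtain c K C where c: "c > 0" "K \<ge> 0" and ps: "\<forall>n>0. \<forall>Es\<subseteq>pointed {..<n}.
     c * (real (card Es) / (real n * 2 ^ n)) ^ C - K / real n
       \<le> real (card (copies n ?D ?P Es)) / (real n ^ card ?D * 2 ^ n)"
    unfolding power_saving_def by (elim exE conjE) (rule that)
  \<comment> \<open>\<open>C\<close> may be 0, so the root is taken of order \<open>Suc C\<close>;
    the extra factor is harmless as densities are at most 1. Likewise \<open>K + 1\<close> keeps
    \<open>q\<close> positive when \<open>K\<close> is 0.\<close>
  define m where "m = Suc C"
  define q where "q = (K + 1) / c"
  define \<epsilon> where "\<epsilon> = 1 / real m"
  have m: "m > 0" "0 < \<epsilon>" "\<epsilon> \<le> 1" and q: "q > 0" using c by (auto simp: m_def \<epsilon>_def q_def)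
  have bound: "real (card W) \<le> 2 * q powr \<epsilon> * (real n powr (-\<epsilon>) * real (card (cube_edges n)))"
    if n: "n > 0" and W: "W \<subseteq> cube_edges n"
      and av: "\<forall>\<psi>. cube_embedding ?d n \<psi> \<longrightarrow> \<not> (\<lambda>f. \<psi> ` f) ` ?Y \<subseteq> W" for n W
  proof -
    define Es where "Es = {(B, y) \<in> pointed {..<n}. {B, insert y B} \<in> W}"
    define \<delta> where "\<delta> = real (card Es) / (real n * 2 ^ n)"
    have Es: "Es \<subseteq> pointed {..<n}" by (auto simp: Es_def)
    have "card (copies n ?D ?P Es) = 0"
      unfolding Es_def by (simp only: copies_empty_if_avoiding[OF G assms(6) av] card.empty)
    with ps[rule_format, OF n Es] have le: "c * \<delta> ^ C \<le> K / real n" by (simp add: \<delta>_def)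
    have "card Es \<le> n * 2 ^ n"
      using card_mono[OF finite_pointed Es] card_pointed_le[of n] by fastforce
    then have "real (card Es) \<le> real n * 2 ^ n" by (metis of_nat_le_iff of_nat_mult of_nat_numeral of_nat_power)
    then have \<delta>: "0 \<le> \<delta>" "\<delta> \<le> 1" using n by (auto simp: \<delta>_def divide_le_eq)
    have "c * \<delta> ^ m \<le> c * \<delta> ^ C" using \<delta> c by (simp add: m_def mult_left_le_one_le)
    also note le
    also have "K / real n \<le> (K + 1) / real n" by (intro divide_right_mono) auto
    finally have "\<delta> ^ m \<le> q / real n" using c n by (simp add: q_def field_simps)
    then have "root m (\<delta> ^ m) \<le> root m (q / real n)" using m by (intro real_root_le_mono)
    moreover have "root m (\<delta> ^ m) = \<delta>" using m \<delta> by (intro real_root_power_cancel)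
    moreover have "root m (q / real n) = (q / real n) powr \<epsilon>"
      using m q n by (simp add: root_powr_inverse \<epsilon>_def)
    ultimately have "\<delta> \<le> (q / real n) powr \<epsilon>" by simp
    also have "\<dots> = q powr \<epsilon> * real n powr (-\<epsilon>)"
      using q n by (simp add: powr_divide powr_minus field_simps)
    finally have le: "\<delta> * (real n * 2 ^ n) \<le> q powr \<epsilon> * real n powr (-\<epsilon>) * (real n * 2 ^ n)"
      by (intro mult_right_mono) auto
    have "real (card W) \<le> \<delta> * (real n * 2 ^ n)"
      using card_le_card_pairs[OF W] n by (simp add: \<delta>_def Es_def)
    from order_trans[OF this le]
    have "real (card W) \<le> q powr \<epsilon> * real n powr (-\<epsilon>) * (real n * 2 ^ n)" .
    \<comment> \<open>Densities are normalised by twice the number of cube edges, hence the factor 2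
      in \<open>bound\<close>.\<close>
    moreover have "real n * 2 ^ n = 2 * real (card (cube_edges n))"
      using n by (cases n) (simp_all add: card_cube_edges algebra_simps)
    ultimately show ?thesis by (simp only: mult_ac)
  qed
  \<comment> \<open>The bound also covers the junk value \<open>Max {}\<close>, which \<open>cube_ex\<close> would take if \<open>Y\<close> were empty.\<close>
  define M where "M = real (Max ({} :: nat set))"
  have "norm (real (cube_ex ?d n ?Y)) \<le> (2 * q powr \<epsilon> + M) * norm (real n powr (-\<epsilon>) * real (card (cube_edges n)))"
    if n: "n > 0" for n
  proof -
    let ?A = "{card W | W. W \<subseteq> cube_edges n \<and>
      (\<forall>\<psi>. cube_embedding ?d n \<psi> \<longrightarrow> \<not> (\<lambda>f. \<psi> ` f) ` ?Y \<subseteq> W)}"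
    let ?g = "real n powr (-\<epsilon>) * real (card (cube_edges n))"
    \<comment> \<open>Since \<open>\<epsilon> \<le> 1\<close>, the comparison function is at least 1
      and can absorb the constant \<open>M\<close>.\<close>
    have "1 \<le> real n powr (1 - \<epsilon>) * 2 ^ (n - 1)"
      using n m by (intro mult_ge1_I ge_one_powr_ge_zero) auto
    also have "\<dots> = ?g" using n by (simp add: card_cube_edges powr_diff powr_minus field_simps)
    finally have g: "1 \<le> ?g" .
    have ex: "cube_ex ?d n ?Y = Max ?A" by (simp add: cube_ex_def)
    have "real (Max ?A) \<le> 2 * q powr \<epsilon> * ?g + M * ?g"
    proof (cases "?A = {}")
      case True
      have "M * 1 \<le> M * ?g" using g by (intro mult_left_mono) (auto simp: M_def)
      moreover have "0 \<le> 2 * q powr \<epsilon> * ?g" by simp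
      ultimately show ?thesis unfolding True using M_def by linarith
    next
      case False
      have fin: "finite (cube_edges n)"
        by (rule finite_subset[of _ "Pow (Pow {..<n})"]) (auto simp: cube_edges_def cube_verts_def)
      have "finite ?A"
        by (rule finite_subset[of _ "card ` Pow (cube_edges n)"]) (use fin in auto)
      then have "Max ?A \<in> ?A" using False by (rule Max_in)
      then obtain W where "W \<subseteq> cube_edges n" "\<forall>\<psi>. cube_embedding ?d n \<psi> \<longrightarrow> \<not> (\<lambda>f. \<psi> ` f) ` ?Y \<subseteq> W"
        "Max ?A = card W" by blast
      then have "real (Max ?A) \<le> 2 * q powr \<epsilon> * ?g" using bound[OF n] by simp
      moreover have "0 \<le> M * ?g" by (simp add: M_def)
      ultimately show ?thesis by linarith
    qed
    then show ?thesis using g unfolding ex by (simp add: distrib_right)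
  qed
  then have "(\<lambda>n. real (cube_ex ?d n ?Y)) \<in> O(\<lambda>n. real n powr (-\<epsilon>) * real (card (cube_edges n)))"
    by (intro bigoI[where c = "2 * q powr \<epsilon> + M"] eventually_mono[OF eventually_gt_at_top[of "0::nat"]])
  then show ?thesis using m by blast
qed

end
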